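(* Let $\mathcal{P}$ be an arbitrary finite polysquare translation surface. Let $\alpha$ be a badly approximable number with continued fraction expansion $\alpha=[a_0;a_1,a_2,\ldots]=a_0+\cfrac{1}{a_1+\cfrac{1}{a_2+\cdots}}$ such that for every $i\ge0$ the digit $a_i$ is divisible by the street-LCM of $\mathcal{P}$. Then every half-infinite $1$-directional geodesic with slope $\alpha$ on $\mathcal{P}$ exhibits superdensity: there is a constant $C$ such that for every integer $n\ge1$ and every point $P\in\mathcal{P}$, the initial segment of length $Cn$ of the geodesic comes within distance $1/n$ of $P$.
   Context: A finite polysquare region is a connected polygon in the plane tiled by finitely many closed unit squares (its square faces) with integer vertices, such that any two square faces are disjoint, meet at a single point, or share a common edge, and any two square faces are joined by a chain of square faces in which consecutive ones share an edge. A finite polysquare translation surface is obtained from such a region by identifying boundary edges in pairs, each pair consisting of two parallel edges with inward normals in opposite directions, glued by translation; it is a flat surface with finitely many conical singularities at vertices. A (horizontal or vertical) street is a maximal strip of consecutive square faces arranged horizontally or vertically (a cylinder on the surface); its length is the number of its square faces. The street-LCM of $\mathcal{P}$ is the least common multiple of the lengths of all horizontal and vertical streets. A $1$-directional geodesic of slope $\alpha$ is a straight-line trajectory of constant direction $(1,\alpha)$, parametrized by arc length. A number is badly approximable if its continued fraction digits are bounded. *)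

theory Defs
  imports "HOL-Analysis.Analysis"
begin

text \<open>A face is named by the integer coordinates of its lower left vertex. Distinct faces of the
  integer grid automatically are disjoint, meet in a vertex, or share an edge.\<close>

type_synonym face = "int \<times> int"

datatype side = East | North | West | South

fun opposite :: "side \<Rightarrow> side" where
  "opposite East = West"
| "opposite North = South"
| "opposite West = East"
| "opposite South = North"

fun step :: "side \<Rightarrow> face \<Rightarrow> face" where
  "step East (i, j) = (i + 1, j)"
| "step North (i, j) = (i, j + 1)"
| "step West (i, j) = (i - 1, j)"
| "step South (i, j) = (i, j - 1)"

definition polysquare_region :: "face set \<Rightarrow> bool" where
  "polysquare_region F \<longleftrightarrow> finite F \<and> F \<noteq> {} \<and>
     (\<forall>s\<in>F. \<forall>t\<in>F. (s, t) \<in> {(s, t). s \<in> F \<and> t \<in> F \<and> (\<exists>d. t = step d s)}\<^sup>*)"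

definition boundary_edges :: "face set \<Rightarrow> (face \<times> side) set" where
  "boundary_edges F = {(s, d). s \<in> F \<and> step d s \<notin> F}"

text \<open>The identification of the boundary edges in pairs is an involution \<open>\<sigma>\<close>. The inward normal
  of side \<open>d\<close> of a face points towards \<open>opposite d\<close>, so edges with opposite inward normals are
  those on opposite sides of their faces.\<close>

definition edge_pairing :: "face set \<Rightarrow> (face \<times> side \<Rightarrow> face \<times> side) \<Rightarrow> bool" where
  "edge_pairing F \<sigma> \<longleftrightarrow> (\<forall>e\<in>boundary_edges F.
     \<sigma> e \<in> boundary_edges F \<and> \<sigma> (\<sigma> e) = e \<and> snd (\<sigma> e) = opposite (snd e))"

definition polysquare_translation_surface ::
  "face set \<Rightarrow> (face \<times> side \<Rightarrow> face \<times> side) \<Rightarrow> bool" where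
  "polysquare_translation_surface F \<sigma> \<longleftrightarrow> polysquare_region F \<and> edge_pairing F \<sigma>"

definition neighbour ::
  "face set \<Rightarrow> (face \<times> side \<Rightarrow> face \<times> side) \<Rightarrow> side \<Rightarrow> face \<Rightarrow> face" where
  "neighbour F \<sigma> d s = (if step d s \<in> F then step d s else fst (\<sigma> (s, d)))"

text \<open>The pair \<open>(s, p)\<close> stands for the point \<open>s + p\<close> of the plane, seen as a point of
  the closed face \<open>s\<close>. Faces are glued along edges only: two faces that meet in the plane in just a
  vertex are not joined there, unless edge identifications force it; otherwise the quotient could
  fail to be a surface.\<close>

type_synonym local_point = "face \<times> (real \<times> real)"

definition unit_square :: "(real \<times> real) set" where
  "unit_square = {0..1} \<times> {0..1}"

definition glue ::
  "face set \<Rightarrow> (face \<times> side \<Rightarrow> face \<times> side) \<Rightarrow> (local_point \<times> local_point) set" where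
  "glue F \<sigma> =
     {((s, (1, y)), (neighbour F \<sigma> East s, (0, y))) | s y. s \<in> F \<and> y \<in> {0..1}} \<union>
     {((s, (x, 1)), (neighbour F \<sigma> North s, (x, 0))) | s x. s \<in> F \<and> x \<in> {0..1}}"

definition glue_equiv ::
  "face set \<Rightarrow> (face \<times> side \<Rightarrow> face \<times> side) \<Rightarrow> (local_point \<times> local_point) set" where
  "glue_equiv F \<sigma> = (glue F \<sigma> \<union> (glue F \<sigma>)\<inverse>)\<^sup>*"

definition surface_point ::
  "face set \<Rightarrow> (face \<times> side \<Rightarrow> face \<times> side) \<Rightarrow> face \<Rightarrow> real \<times> real \<Rightarrow> local_point set" where
  "surface_point F \<sigma> s p = glue_equiv F \<sigma> `` {(s, p)}"

definition surface ::
  "face set \<Rightarrow> (face \<times> side \<Rightarrow> face \<times> side) \<Rightarrow> local_point set set" where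
  "surface F \<sigma> = (F \<times> unit_square) // glue_equiv F \<sigma>"

text \<open>The flat distance is the infimum of the lengths of broken lines, each piece of which is a
  segment inside one closed face.\<close>

inductive broken_line ::
  "face set \<Rightarrow> (face \<times> side \<Rightarrow> face \<times> side) \<Rightarrow>
     local_point set \<Rightarrow> local_point set \<Rightarrow> real \<Rightarrow> bool"
  for F \<sigma> where
  trivial: "X \<in> surface F \<sigma> \<Longrightarrow> broken_line F \<sigma> X X 0"
| segment: "broken_line F \<sigma> X Y l \<Longrightarrow> (s, p) \<in> Y \<Longrightarrow> q \<in> unit_square \<Longrightarrow>
     broken_line F \<sigma> X (surface_point F \<sigma> s q) (l + dist p q)"

definition surface_dist ::
  "face set \<Rightarrow> (face \<times> side \<Rightarrow> face \<times> side) \<Rightarrow>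
     local_point set \<Rightarrow> local_point set \<Rightarrow> real" where
  "surface_dist F \<sigma> X Y = Inf {l. broken_line F \<sigma> X Y l}"

text \<open>Angle of the closed unit square at \<open>p\<close>: \<open>2 * pi\<close> in the interior, \<open>pi\<close> on an open
  edge, \<open>pi / 2\<close> at a vertex. Summing over all local representatives gives the total angle at a
  point of the surface.\<close>

definition local_angle :: "real \<times> real \<Rightarrow> real" where
  "local_angle p = 2 * pi * (if fst p \<in> {0<..<1} then 1 else 1 / 2) *
     (if snd p \<in> {0<..<1} then 1 else 1 / 2)"

definition cone_angle :: "local_point set \<Rightarrow> real" where
  "cone_angle X = (\<Sum>(s, p)\<in>X. local_angle p)"

definition singular :: "local_point set \<Rightarrow> bool" where
  "singular X \<longleftrightarrow> cone_angle X \<noteq> 2 * pi"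

definition horizontal_street ::
  "face set \<Rightarrow> (face \<times> side \<Rightarrow> face \<times> side) \<Rightarrow> face \<Rightarrow> face set" where
  "horizontal_street F \<sigma> s = range (\<lambda>k. (neighbour F \<sigma> East ^^ k) s)"

definition vertical_street ::
  "face set \<Rightarrow> (face \<times> side \<Rightarrow> face \<times> side) \<Rightarrow> face \<Rightarrow> face set" where
  "vertical_street F \<sigma> s = range (\<lambda>k. (neighbour F \<sigma> North ^^ k) s)"

definition street_LCM :: "face set \<Rightarrow> (face \<times> side \<Rightarrow> face \<times> side) \<Rightarrow> nat" where
  "street_LCM F \<sigma> = Lcm (card ` (horizontal_street F \<sigma> ` F \<union> vertical_street F \<sigma> ` F))"

text \<open>Arc-length parametrized trajectories in direction \<open>(1, \<alpha>)\<close>, locally straight to both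
  sides of each time. Being half-infinite, the trajectory meets no singularity at positive times,
  though it may start at one. At a point of total angle \<open>2 * pi\<close> the incoming and
  outgoing directions are unique, so they make an angle \<open>pi\<close>, also at a vertex.\<close>

definition unit_direction :: "real \<Rightarrow> real \<times> real" where
  "unit_direction \<alpha> = (1 / sqrt (1 + \<alpha>\<^sup>2)) *\<^sub>R (1, \<alpha>)"

definition half_infinite_geodesic ::
  "face set \<Rightarrow> (face \<times> side \<Rightarrow> face \<times> side) \<Rightarrow> real \<Rightarrow> (real \<Rightarrow> local_point set) \<Rightarrow> bool" where
  "half_infinite_geodesic F \<sigma> \<alpha> \<gamma> \<longleftrightarrow>
     (\<forall>t\<ge>0. \<gamma> t \<in> surface F \<sigma>) \<and>
     (\<forall>t>0. \<not> singular (\<gamma> t)) \<and>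
     (\<forall>t\<ge>0. \<exists>\<epsilon>>0. \<exists>(s, p)\<in>\<gamma> t. \<forall>h\<in>{0..\<epsilon>}.
        p + h *\<^sub>R unit_direction \<alpha> \<in> unit_square \<and>
        \<gamma> (t + h) = surface_point F \<sigma> s (p + h *\<^sub>R unit_direction \<alpha>)) \<and>
     (\<forall>t>0. \<exists>\<epsilon>\<in>{0<..t}. \<exists>(s, p)\<in>\<gamma> t. \<forall>h\<in>{0..\<epsilon>}.
        p - h *\<^sub>R unit_direction \<alpha> \<in> unit_square \<and>
        \<gamma> (t - h) = surface_point F \<sigma> s (p - h *\<^sub>R unit_direction \<alpha>))"

definition superdense ::
  "face set \<Rightarrow> (face \<times> side \<Rightarrow> face \<times> side) \<Rightarrow> (real \<Rightarrow> local_point set) \<Rightarrow> bool" where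
  "superdense F \<sigma> \<gamma> \<longleftrightarrow> (\<exists>C::real. \<forall>n::nat. n \<ge> 1 \<longrightarrow>
     (\<forall>P\<in>surface F \<sigma>. \<exists>t\<in>{0..C * real n}. surface_dist F \<sigma> (\<gamma> t) P \<le> 1 / real n))"

fun finite_cfrac :: "(nat \<Rightarrow> int) \<Rightarrow> nat \<Rightarrow> real" where
  "finite_cfrac a 0 = of_int (a 0)"
| "finite_cfrac a (Suc n) = of_int (a 0) + 1 / finite_cfrac (\<lambda>i. a (Suc i)) n"

definition cfrac_expansion :: "real \<Rightarrow> (nat \<Rightarrow> int) \<Rightarrow> bool" where
  "cfrac_expansion \<alpha> a \<longleftrightarrow> (\<forall>i\<ge>1. a i \<ge> 1) \<and> finite_cfrac a \<longlonglongrightarrow> \<alpha>"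

definition badly_approximable :: "real \<Rightarrow> bool" where
  "badly_approximable \<alpha> \<longleftrightarrow> (\<exists>a. cfrac_expansion \<alpha> a \<and> (\<exists>B. \<forall>i. \<bar>a i\<bar> \<le> B))"

end

(* Record the successive crossings of vertical edges by the geodesic: with b the fractional part of
   alpha, this is an orbit of a skew product over the rotation by b. A step moves the face by east
   and raises the height by b; if the height passes 1 (a carry), north is applied first. The integer
   part of alpha does not matter, since it is divisible by the street-LCM L and the L-th powers of
   east and north are trivial. Inducing on the times just after a carry gives, after rescaling, the
   same system with east and north exchanged and with b replaced by the fractional part of 1/b:
   this is the divisibility of the next digit by L.

   Going back through one such step, a visit to a face becomes a visit to its whole east (or north)
   cycle; as east and north together act transitively, after boundedly many steps every face is
   visited within bounded time, at all levels uniformly. Each further step multiplies the precision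
   of a visit by b and the time by 1/b up to a bounded additive error, so that precision 1/n costs
   time O(n). *)
theory Submission
  imports Defs
begin

section \<open>Skew products over rotations\<close>

text \<open>Renormalization passes through infinitely many systems, and the bounds must not depend
  on the level. Hence the estimates are stated for all orbits of all pairs satisfying
  \<open>transitive_pair\<close>, a class closed under exchanging the two permutations. Bounded
  digits supply the uniformity twice: they keep the rotation numbers away from 0, so that one level
  costs at most a factor \<open>B + 1\<close> in time, and away from 1, so that each level gains a
  definite factor in precision. The other obstacle is geometric. The coding relies on an interior
  point of a vertical edge having one face on each side, which fails at vertices of faces. Modulo
  integer vectors the geodesic is a line on a torus, and a line of irrational slope passes through
  the lattice point at most once. The coding starts after that time, and the delay is absorbed into
  the final constant.\<close>

definition transitive_pair :: "'a set \<Rightarrow> nat \<Rightarrow> ('a \<Rightarrow> 'a) \<Rightarrow> ('a \<Rightarrow> 'a) \<Rightarrow> bool" where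
  "transitive_pair F L p q \<longleftrightarrow> finite F \<and> F \<noteq> {} \<and> bij_betw p F F \<and> bij_betw q F F \<and>
     (\<forall>s\<in>F. (p ^^ L) s = s) \<and> (\<forall>s\<in>F. (q ^^ L) s = s) \<and>
     (\<forall>X\<subseteq>F. X \<noteq> {} \<longrightarrow> p ` X \<subseteq> X \<longrightarrow> q ` X \<subseteq> X \<longrightarrow> X = F)"

lemma transitive_pair_swap: "transitive_pair F L p q \<Longrightarrow> transitive_pair F L q p"
  unfolding transitive_pair_def by blast

lemma funpow_mult_fixed:
  assumes "(f ^^ n) x = x"
  shows "(f ^^ (n * k)) x = x"
  using assms by (induction k) (auto simp: funpow_add)

lemma bij_betw_funpow: "bij_betw f A A \<Longrightarrow> bij_betw (f ^^ n) A A"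
  by (induction n) (auto intro: bij_betw_trans simp del: bij_betw_id_iff)

text \<open>Where both branches keep the height in \<open>[0, 1]\<close>, that is at height \<open>1 - b\<close>, either may be
  taken. This makes the notion invariant under the reflection of heights in \<open>induced_orbit\<close>.\<close>

definition rotation_orbit ::
  "'a set \<Rightarrow> ('a \<Rightarrow> 'a) \<Rightarrow> ('a \<Rightarrow> 'a) \<Rightarrow> real \<Rightarrow> (nat \<Rightarrow> 'a) \<Rightarrow> (nat \<Rightarrow> real) \<Rightarrow> (nat \<Rightarrow> bool) \<Rightarrow> bool" where
  "rotation_orbit F p q b s y c \<longleftrightarrow> (\<forall>i. s i \<in> F \<and> 0 \<le> y i \<and> y i \<le> 1 \<and>
     s (Suc i) = (if c i then p (q (s i)) else p (s i)) \<and>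
     y (Suc i) = (if c i then y i + b - 1 else y i + b))"

lemma rotation_orbitD:
  assumes "rotation_orbit F p q b s y c"
  shows "s i \<in> F" "0 \<le> y i" "y i \<le> 1"
    "c i \<Longrightarrow> s (Suc i) = p (q (s i))" "\<not> c i \<Longrightarrow> s (Suc i) = p (s i)"
    "c i \<Longrightarrow> y (Suc i) = y i + b - 1" "\<not> c i \<Longrightarrow> y (Suc i) = y i + b"
  using assms unfolding rotation_orbit_def by auto

lemma rotation_orbit_run:
  assumes orb: "rotation_orbit F p q b s y c" and run: "\<And>i. i < j \<Longrightarrow> \<not> c (k + i)"
  shows "s (k + j) = (p ^^ j) (s k) \<and> y (k + j) = y k + real j * b"
  using run
proof (induction j)
  case (Suc j)
  then have "\<not> c (k + j)" and IH: "s (k + j) = (p ^^ j) (s k)" "y (k + j) = y k + real j * b"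
    by auto
  then show ?case
    using rotation_orbitD(5,7)[OF orb, of "k + j"] by (simp add: algebra_simps)
qed simp

lemma rotation_orbit_carry_exists:
  assumes orb: "rotation_orbit F p q b s y c" and b: "0 < b"
  shows "\<exists>i\<ge>k. c i"
proof (rule ccontr)
  assume "\<not> ?thesis"
  then have "y (k + j) = y k + real j * b" for j
    using rotation_orbit_run[OF orb, of j k] by auto
  moreover obtain j :: nat where "1 < real j * b"
    using reals_Archimedean3[OF b] by blast
  ultimately show False
    using rotation_orbitD(2)[OF orb, of k] rotation_orbitD(3)[OF orb, of "k + j"] by simp
qed

text \<open>The times just after a carry form an orbit of the same kind with the permutations exchanged:
  rescaled by \<open>b\<close> and reflected, the heights move by \<open>\<theta>\<close>. Between two of these times \<open>p\<close> is
  applied \<open>a\<close> or \<open>a + 1\<close> times, that is, effectively not at all or once, as \<open>p ^^ a\<close> is the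
  identity.\<close>

lemma induced_orbit:
  assumes tp: "transitive_pair F L p q"
    and orb: "rotation_orbit F p q b s y c"
    and b: "0 < b" "1 / b = real a + \<theta>" and \<theta>: "0 < \<theta>" "\<theta> < 1" and a: "L dvd a" "1 \<le> a"
  obtains T t z C where
    "rotation_orbit F q p \<theta> t z C"
    "\<And>n. 1 \<le> T n" "\<And>n. c (T n - 1)" "\<And>n. t n = q (s (T n - 1))"
    "\<And>n. y (T n) = b * (1 - z n)"
    "\<And>n j. j < (if C n then a else a - 1) \<Longrightarrow> \<not> c (T n + j)"
    "\<And>n. c (T n + (if C n then a else a - 1))"
    "\<And>n j. j \<le> (if C n then a else a - 1) \<Longrightarrow> s (T n + j) = (p ^^ Suc j) (t n)"
    "\<And>n j. j \<le> (if C n then a else a - 1) \<Longrightarrow> y (T n + j) = y (T n) + real j * b"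
    "\<And>n j. j \<le> (if C n then a else a - 1) \<Longrightarrow> real (T n + j) \<le> (real n + 2) / b"
proof -
  define nxt where "nxt k = (LEAST i. k \<le> i \<and> c i)" for k
  have nxt: "k \<le> nxt k" "c (nxt k)" for k
    using LeastI_ex[of "\<lambda>i. k \<le> i \<and> c i"] rotation_orbit_carry_exists[OF orb b(1)]
    unfolding nxt_def by blast+
  have nxt_less: "\<not> c i" if "k \<le> i" "i < nxt k" for i k
    using not_less_Least[of i "\<lambda>i. k \<le> i \<and> c i"] that unfolding nxt_def by blast
  \<comment> \<open>\<open>T n\<close> is one past the n-th carry, counted from 0;
    \<open>m n\<close> below is the number of carry-free steps before the next carry.\<close>
  define T where "T = rec_nat (Suc (nxt 0)) (\<lambda>_ k. Suc (nxt k))"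
  have T0: "T 0 = Suc (nxt 0)" and TS: "T (Suc n) = Suc (nxt (T n))" for n
    by (simp_all add: T_def)
  define m where "m n = nxt (T n) - T n" for n
  have Tm: "T n + m n = nxt (T n)" for n
    using nxt(1)[of "T n"] by (simp add: m_def)
  have TS': "T (Suc n) = Suc (T n + m n)" for n
    using TS Tm by simp
  have pos: "1 \<le> T n" for n
    by (cases n) (simp_all add: T0 TS)
  have cT: "c (T n - 1)" for n
    by (cases n) (simp_all add: T0 TS nxt)
  have norun: "\<not> c (T n + j)" if "j < m n" for n j
    using nxt_less[of "T n" "T n + j"] that Tm[of n] by simp
  have run: "s (T n + j) = (p ^^ j) (s (T n))" "y (T n + j) = y (T n) + real j * b"
    if "j \<le> m n" for n j
    using rotation_orbit_run[OF orb, of j "T n"] norun that by auto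
  \<comment> \<open>The face is recorded between the \<open>q\<close> and the \<open>p\<close> of a
    carry step. From there to the next record \<open>p\<close> acts \<open>m n + 1\<close> times and
    then \<open>q\<close> once, which is the shape of an orbit with the roles exchanged.\<close>
  define t where "t n = q (s (T n - 1))" for n
  have sT: "s (T n) = p (t n)" for n
    using rotation_orbitD(4)[OF orb cT[of n]] pos[of n] by (simp add: t_def)
  have yT: "y (T n) \<le> b" for n
    using rotation_orbitD(6)[OF orb cT[of n]] rotation_orbitD(3)[OF orb, of "T n - 1"] pos[of n]
    by simp
  \<comment> \<open>From one block to the next the height drops by \<open>\<theta> * b\<close> or
    rises by \<open>(1 - \<theta>) * b\<close>; the reflection turns this into the moves by
    \<open>\<theta>\<close> and \<open>\<theta> - 1\<close> of an orbit.\<close>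
  define z where "z n = 1 - y (T n) / b" for n
  have yz: "y (T n) = b * (1 - z n)" for n
    using b(1) by (simp add: z_def)
  have z01: "0 \<le> z n" "z n \<le> 1" for n
    using yT[of n] rotation_orbitD(2)[OF orb, of "T n"] b(1) by (simp_all add: z_def)
  have yS: "y (T (Suc n)) = y (T n) + (real (m n) + 1) * b - 1" for n
    using rotation_orbitD(6)[OF orb nxt(2)[of "T n"]] run(2)[of "m n" n] TS[of n] Tm[of n]
    by (simp add: algebra_simps)
  have zS: "z (Suc n) = z n + \<theta> + (real a - (real (m n) + 1))" for n
    using yS[of n] b by (simp add: z_def field_simps)
  \<comment> \<open>Both heights lie in the unit interval, so the integer
    \<open>a - (m n + 1)\<close> lies strictly between -2 and 1.\<close>
  have m_cases: "m n = a - 1 \<or> m n = a" for n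
  proof -
    have "real a - (real (m n) + 1) < 1" "real a - (real (m n) + 1) > - 2"
      using zS[of n] z01[of n] z01[of "Suc n"] \<theta> by linarith+
    then show ?thesis by linarith
  qed
  define C where "C n \<longleftrightarrow> m n = a" for n
  have mC: "m n = (if C n then a else a - 1)" for n
    using m_cases[of n] by (auto simp: C_def)
  have pF: "(p ^^ a) u = u" if "u \<in> F" for u
    using tp that a(1) unfolding transitive_pair_def dvd_def
    by (auto intro: funpow_mult_fixed)
  have tF: "t n \<in> F" for n
    using tp bij_betwE[of q F F] rotation_orbitD(1)[OF orb, of "T n - 1"]
    unfolding t_def transitive_pair_def by simp
  have sTj: "s (T n + j) = (p ^^ Suc j) (t n)" if "j \<le> m n" for n j
    using run(1)[OF that] sT[of n] by (simp add: funpow_swap1)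
  have tS: "t (Suc n) = (if C n then q (p (t n)) else q (t n))" for n
  proof -
    have "t (Suc n) = q ((p ^^ Suc (m n)) (t n))"
      using sTj[of "m n" n] TS'[of n] by (simp add: t_def)
    then show ?thesis
      using mC[of n] pF[OF tF[of n]] a(2) by (cases "C n") auto
  qed
  have orb': "rotation_orbit F q p \<theta> t z C"
    unfolding rotation_orbit_def
  proof (intro allI conjI)
    fix n
    show "z (Suc n) = (if C n then z n + \<theta> - 1 else z n + \<theta>)"
      using zS[of n] mC[of n] a(2) by (auto simp: of_nat_diff)
  qed (use tF z01 tS in auto)
  \<comment> \<open>Every step adds \<open>b\<close>, and the \<open>n + 1\<close> carries before
    time \<open>T n\<close> each subtract 1. As heights stay in the unit interval, this converts
    block numbers into times.\<close>
  have count: "y (T n) = y 0 + b * real (T n) - (real n + 1)" for n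
  proof (induction n)
    case 0
    have "\<not> c i" if "i < nxt 0" for i using nxt_less[of 0 i] that by simp
    then have "y (nxt 0) = y 0 + real (nxt 0) * b"
      using rotation_orbit_run[OF orb, of "nxt 0" 0] by simp
    then show ?case
      using rotation_orbitD(6)[OF orb nxt(2)[of 0]] T0 by (simp add: algebra_simps)
  next
    case (Suc n)
    then show ?case using yS[of n] TS'[of n] by (simp add: algebra_simps)
  qed
  have time: "real (T n + j) \<le> (real n + 2) / b" if "j \<le> m n" for n j
  proof -
    have "b * real (T n + j) \<le> real n + 2"
      using count[of n] run(2)[OF that] rotation_orbitD(3)[OF orb, of "T n + j"]
        rotation_orbitD(2)[OF orb, of 0] by (simp add: algebra_simps)
    then show ?thesis using b(1) by (simp add: field_simps)
  qed
  show ?thesis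
    by (rule that[of t z C T]) (use orb' pos cT t_def yz norun Tm nxt(2) sTj run(2) time mC in \<open>auto simp del: of_nat_add\<close>)
qed

text \<open>Asking also for the branch \<open>\<kappa>\<close> taken by the target keeps the orbit and the target together
  throughout a block of steps between two carries.\<close>

definition visits ::
  "'a set \<Rightarrow> ('a \<Rightarrow> 'a) \<Rightarrow> ('a \<Rightarrow> 'a) \<Rightarrow> real \<Rightarrow> real \<Rightarrow> real \<Rightarrow> bool" where
  "visits F p q b N e \<longleftrightarrow> (\<forall>s y c. rotation_orbit F p q b s y c \<longrightarrow>
     (\<forall>s0\<in>F. \<forall>y0\<in>{0..1}. \<forall>\<kappa>. (if \<kappa> then 1 \<le> y0 + b else y0 + b \<le> 1) \<longrightarrow>
       (\<exists>i. real i \<le> N \<and> s i = s0 \<and> c i = \<kappa> \<and> \<bar>y i - y0\<bar> \<le> e)))"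

lemma visitsD:
  assumes "visits F p q b N e" "rotation_orbit F p q b s y c" "s0 \<in> F" "y0 \<in> {0..1}"
    "if \<kappa> then 1 \<le> y0 + b else y0 + b \<le> 1"
  shows "\<exists>i. real i \<le> N \<and> s i = s0 \<and> c i = \<kappa> \<and> \<bar>y i - y0\<bar> \<le> e"
  using assms(1)[unfolded visits_def, rule_format, OF assms(2-5)] .

lemma visits_mono:
  assumes "visits F p q b N e" "N \<le> N'" "e \<le> e'"
  shows "visits F p q b N' e'"
  unfolding visits_def
proof (intro allI impI ballI)
  fix s y c s0 y0 \<kappa>
  assume "rotation_orbit F p q b s y c" "s0 \<in> F" "y0 \<in> {0..1}"
    "if \<kappa> then 1 \<le> y0 + b else y0 + b \<le> 1"
  from visitsD[OF assms(1) this]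
  obtain i where "real i \<le> N" "s i = s0" "c i = \<kappa>" "\<bar>y i - y0\<bar> \<le> e" by blast
  then show "\<exists>i. real i \<le> N' \<and> s i = s0 \<and> c i = \<kappa> \<and> \<bar>y i - y0\<bar> \<le> e'"
    using assms(2,3) by (intro exI[of _ i]) linarith
qed

text \<open>A target height \<open>y0 = (r + j) * b\<close> with \<open>0 \<le> r < 1\<close> is
  reached \<open>j\<close> steps after the start of a block at height \<open>r * b\<close>, that is,
  at induced height \<open>1 - r\<close>. So the induced orbit is made to visit \<open>1 - r\<close>
  at the face pulled back by \<open>p ^^ Suc j\<close>; an error in the induced height shrinks by
  the factor \<open>b\<close> on the way back.\<close>

lemma visits_step:
  assumes tp: "transitive_pair F L p q"
    and b: "0 < b" "1 / b = real a + \<theta>" and \<theta>: "0 < \<theta>" "\<theta> < 1" and a: "L dvd a" "1 \<le> a"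
    and vis: "visits F q p \<theta> N e"
  shows "visits F p q b ((N + 2) / b) (e * b)"
  unfolding visits_def
proof (intro allI impI ballI)
  fix s :: "nat \<Rightarrow> 'a" and y c s0 \<kappa> and y0 :: real
  assume orb: "rotation_orbit F p q b s y c" and s0: "s0 \<in> F" and y0: "y0 \<in> {0..1}"
    and valid: "if \<kappa> then 1 \<le> y0 + b else y0 + b \<le> 1"
  obtain T t z C where orb': "rotation_orbit F q p \<theta> t z C"
    and yT: "\<And>n. y (T n) = b * (1 - z n)"
    and norun: "\<And>n j. j < (if C n then a else a - 1) \<Longrightarrow> \<not> c (T n + j)"
    and carry: "\<And>n. c (T n + (if C n then a else a - 1))"
    and sTj: "\<And>n j. j \<le> (if C n then a else a - 1) \<Longrightarrow> s (T n + j) = (p ^^ Suc j) (t n)"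
    and yTj: "\<And>n j. j \<le> (if C n then a else a - 1) \<Longrightarrow> y (T n + j) = y (T n) + real j * b"
    and time: "\<And>n j. j \<le> (if C n then a else a - 1) \<Longrightarrow> real (T n + j) \<le> (real n + 2) / b"
    using induced_orbit[OF tp orb b \<theta> a] by metis
  define j where "j = nat \<lfloor>y0 / b\<rfloor>"
  define r where "r = y0 / b - real j"
  have r: "0 \<le> r" "r < 1" and y0r: "y0 = (r + real j) * b"
    using y0 b(1) by (auto simp: r_def j_def) linarith
  have top: "r + real j \<le> real a + \<theta>"
    using y0 b(1) unfolding b(2)[symmetric] by (simp add: r_def divide_right_mono)
  have key: "(1 \<le> y0 + b) = (real a + \<theta> \<le> r + real j + 1)"
    "(y0 + b \<le> 1) = (r + real j + 1 \<le> real a + \<theta>)"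
  proof -
    have "r + real j + 1 = (y0 + b) / b"
      using b(1) by (simp add: r_def add_divide_distrib)
    then show "(1 \<le> y0 + b) = (real a + \<theta> \<le> r + real j + 1)"
      "(y0 + b \<le> 1) = (r + real j + 1 \<le> real a + \<theta>)"
      unfolding b(2)[symmetric] using b(1) by (simp_all add: divide_le_cancel)
  qed
  \<comment> \<open>\<open>K\<close> selects a block length that is admissible at induced height
    \<open>1 - r\<close> and for which position \<open>j\<close> is the last one exactly if
    \<open>\<kappa>\<close>, since the carry ends the block.\<close>
  obtain K where K: "if K then r \<le> \<theta> else \<theta> \<le> r"
    "if \<kappa> then j = (if K then a else a - 1) else j < (if K then a else a - 1)"
  proof (cases \<kappa>)
    case True
    then have "real a + \<theta> \<le> r + real j + 1" using valid key by simp
    then have "j = a \<or> j = a - 1" using top r \<theta> by linarith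
    then show ?thesis
    proof
      assume "j = a"
      then show ?thesis using that[of True] top True by simp
    next
      assume "j = a - 1"
      then show ?thesis
        using that[of False] \<open>real a + \<theta> \<le> r + real j + 1\<close> True a(2) by (simp add: of_nat_diff)
    qed
  next
    case False
    then have le: "r + real j + 1 \<le> real a + \<theta>" using valid key by simp
    show ?thesis
    proof (cases "r \<le> \<theta>")
      case True
      then have "j < a" using le r \<theta> by linarith
      then show ?thesis using that[of True] True False by simp
    next
      case notle: False
      then have "real j + 1 < real a" using le by linarith
      then show ?thesis using that[of False] notle False by simp
    qed
  qed
  have "bij_betw (p ^^ Suc j) F F"
    using tp by (intro bij_betw_funpow) (simp add: transitive_pair_def)
  then obtain t0 where t0: "t0 \<in> F" "(p ^^ Suc j) t0 = s0"
    using s0 unfolding bij_betw_def by (metis imageE)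
  have "1 - r \<in> {0..1}" "if K then 1 \<le> (1 - r) + \<theta> else (1 - r) + \<theta> \<le> 1"
    using r K(1) by (auto split: if_splits)
  then obtain n where n: "real n \<le> N" "t n = t0" "C n = K" "\<bar>z n - (1 - r)\<bar> \<le> e"
    using visitsD[OF vis orb' t0(1), of "1 - r" K] by blast
  have jm: "j \<le> (if C n then a else a - 1)"
    using K(2) n(3) by (auto split: if_splits)
  have "real (T n + j) \<le> (N + 2) / b"
    using time[OF jm] n(1) b(1) by (simp add: field_simps)
  moreover have "s (T n + j) = s0" using sTj[OF jm] n(2) t0(2) by simp
  moreover have "c (T n + j) = \<kappa>"
    using K(2) n(3) norun[of j n] carry[of n] by (cases \<kappa>) auto
  moreover have "y (T n + j) - y0 = - (z n - (1 - r)) * b"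
    using yTj[OF jm] yT[of n] y0r by (simp add: algebra_simps)
  then have "\<bar>y (T n + j) - y0\<bar> \<le> e * b"
    using n(4) b(1) by (simp add: abs_mult)
  ultimately show "\<exists>i. real i \<le> (N + 2) / b \<and> s i = s0 \<and> c i = \<kappa> \<and> \<bar>y i - y0\<bar> \<le> e * b"
    by blast
qed

section \<open>Reaching every face within bounded time\<close>

definition sees ::
  "'a set \<Rightarrow> ('a \<Rightarrow> 'a) \<Rightarrow> ('a \<Rightarrow> 'a) \<Rightarrow> real \<Rightarrow> real \<Rightarrow> nat \<Rightarrow> bool" where
  "sees F p q b N r \<longleftrightarrow> (\<forall>s y c. rotation_orbit F p q b s y c \<longrightarrow>
     (\<exists>X\<subseteq>F. X \<noteq> {} \<and> X \<subseteq> s ` {i. real i \<le> N} \<and> p ` X \<subseteq> X \<and> (X = F \<or> r \<le> card X)))"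

text \<open>As \<open>L\<close> divides \<open>a\<close>, a block of steps between two carries runs through a full cycle of \<open>p\<close>.\<close>

lemma sees_saturation:
  assumes tp: "transitive_pair F L p q" and orb: "rotation_orbit F p q b s y c"
    and b: "0 < b" "1 / b = real a + \<theta>" and \<theta>: "0 < \<theta>" "\<theta> < 1" and a: "L dvd a" "1 \<le> a"
    and vis: "\<And>t z C. rotation_orbit F q p \<theta> t z C \<Longrightarrow>
      \<exists>X\<subseteq>F. X \<subseteq> t ` {i. real i \<le> N} \<and> P X"
  obtains X where "X \<subseteq> F" "P X" "(\<Union>j. (p ^^ j) ` X) \<subseteq> s ` {i. real i \<le> (N + 2) / b}"
proof -
  obtain T t z C where orb': "rotation_orbit F q p \<theta> t z C"
    and sTj: "\<And>n j. j \<le> (if C n then a else a - 1) \<Longrightarrow> s (T n + j) = (p ^^ Suc j) (t n)"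
    and time: "\<And>n j. j \<le> (if C n then a else a - 1) \<Longrightarrow> real (T n + j) \<le> (real n + 2) / b"
    using induced_orbit[OF tp orb b \<theta> a] by metis
  obtain X where X: "X \<subseteq> F" "X \<subseteq> t ` {i. real i \<le> N}" "P X"
    using vis[OF orb'] by blast
  have "(p ^^ j) x \<in> s ` {i. real i \<le> (N + 2) / b}" if x: "x \<in> X" for j x
  proof -
    obtain n where n: "real n \<le> N" "x = t n" using X x by blast
    have fix_a: "(p ^^ a) x = x"
      using tp X x a(1) unfolding transitive_pair_def dvd_def
      by (auto intro: funpow_mult_fixed)
    \<comment> \<open>The block shows the exponents \<open>Suc i\<close> from 1 to at least
      \<open>a\<close>, so the residue 0 modulo \<open>a\<close> is represented by \<open>a\<close>
      itself. Staying within \<open>a\<close> suits both block lengths.\<close>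
    obtain i where i: "Suc i \<le> a" "(p ^^ Suc i) x = (p ^^ j) x"
    proof (cases "j mod a = 0")
      case True
      then show ?thesis
        using that[of "a - 1"] a(2) fix_a funpow_mod_eq[OF fix_a, of j] by simp
    next
      case False
      then show ?thesis
        using that[of "j mod a - 1"] a(2) funpow_mod_eq[OF fix_a, of j] mod_less_divisor[of a j]
        by (simp add: less_imp_le del: funpow.simps)
    qed
    then have im: "i \<le> (if C n then a else a - 1)" by auto
    have "s (T n + i) = (p ^^ j) x" using sTj[OF im] i n by simp
    moreover have "real (T n + i) \<le> (N + 2) / b"
      using time[OF im] n(1) b(1) by (simp add: field_simps)
    ultimately show ?thesis by (metis (mono_tags, lifting) image_eqI mem_Collect_eq)
  qed
  then show ?thesis using that[OF X(1,3)] by blast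
qed

lemma funpow_orbit_closed: "p ` (\<Union>j. (p ^^ j) ` X) \<subseteq> (\<Union>j. (p ^^ j) ` X)"
proof clarify
  fix j x assume "x \<in> X"
  then show "p ((p ^^ j) x) \<in> (\<Union>j. (p ^^ j) ` X)"
    by (intro UN_I[of "Suc j"]) auto
qed

lemma funpow_orbit_superset: "X \<subseteq> (\<Union>j. (p ^^ j) ` X)"
  by (intro subsetI UN_I[of 0]) auto

lemma funpow_orbit_subset:
  assumes "bij_betw p F F" "X \<subseteq> F"
  shows "(\<Union>j. (p ^^ j) ` X) \<subseteq> F"
  using bij_betw_funpow[OF assms(1)] assms(2) unfolding bij_betw_def by blast

lemma sees_base:
  assumes tp: "transitive_pair F L p q"
    and b: "0 < b" "1 / b = real a + \<theta>" and \<theta>: "0 < \<theta>" "\<theta> < 1" and a: "L dvd a" "1 \<le> a"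
  shows "sees F p q b (2 / b) 0"
  unfolding sees_def
proof (intro allI impI)
  fix s y c assume orb: "rotation_orbit F p q b s y c"
  have vis: "\<exists>X\<subseteq>F. X \<subseteq> t ` {i. real i \<le> 0} \<and> X \<noteq> {}" if "rotation_orbit F q p \<theta> t z C" for t z C
    using rotation_orbitD(1)[OF that] by (intro exI[of _ "{t 0}"]) auto
  obtain X where X: "X \<subseteq> F" "X \<noteq> {}" "(\<Union>j. (p ^^ j) ` X) \<subseteq> s ` {i. real i \<le> (0 + 2) / b}"
    by (rule sees_saturation[OF tp orb b \<theta> a, of 0 "\<lambda>X. X \<noteq> {}", OF vis])
  define Y where "Y = (\<Union>j. (p ^^ j) ` X)"
  have bij: "bij_betw p F F" using tp by (simp add: transitive_pair_def)
  have "p ` Y \<subseteq> Y" "X \<subseteq> Y" "Y \<subseteq> F" "Y \<subseteq> s ` {i. real i \<le> 2 / b}"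
    using funpow_orbit_closed[of p X] funpow_orbit_superset[of X p] funpow_orbit_subset[OF bij X(1)] X(3)
    unfolding Y_def by simp_all
  moreover have "Y \<noteq> {}" using X(2) \<open>X \<subseteq> Y\<close> by blast
  ultimately show "\<exists>X\<subseteq>F. X \<noteq> {} \<and> X \<subseteq> s ` {i. real i \<le> 2 / b} \<and> p ` X \<subseteq> X \<and> (X = F \<or> 0 \<le> card X)"
    by blast
qed

text \<open>The visited set of the induced orbit is closed under \<open>q\<close>. Saturating it by
  \<open>p\<close> either adds a face, or the set was closed under both permutations and hence is
  all of \<open>F\<close>. For this argument \<open>sees\<close> carries closure under its first
  permutation along.\<close>

lemma sees_step:
  assumes tp: "transitive_pair F L p q"
    and b: "0 < b" "1 / b = real a + \<theta>" and \<theta>: "0 < \<theta>" "\<theta> < 1" and a: "L dvd a" "1 \<le> a"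
    and vis: "sees F q p \<theta> N r"
  shows "sees F p q b ((N + 2) / b) (Suc r)"
  unfolding sees_def
proof (intro allI impI)
  fix s y c assume orb: "rotation_orbit F p q b s y c"
  let ?P = "\<lambda>X. X \<noteq> {} \<and> q ` X \<subseteq> X \<and> (X = F \<or> r \<le> card X)"
  have "\<exists>X\<subseteq>F. X \<subseteq> t ` {i. real i \<le> N} \<and> ?P X" if "rotation_orbit F q p \<theta> t z C" for t z C
    using vis[unfolded sees_def, rule_format, OF that] by blast
  then obtain X where X: "X \<subseteq> F" "?P X" "(\<Union>j. (p ^^ j) ` X) \<subseteq> s ` {i. real i \<le> (N + 2) / b}"
    by (rule sees_saturation[OF tp orb b \<theta> a, of N ?P])
  define Y where "Y = (\<Union>j. (p ^^ j) ` X)"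
  have fin: "finite F" and bij: "bij_betw p F F" using tp by (simp_all add: transitive_pair_def)
  have Y: "p ` Y \<subseteq> Y" "X \<subseteq> Y" "Y \<subseteq> F"
    using funpow_orbit_closed[of p X] funpow_orbit_superset[of X p] funpow_orbit_subset[OF bij X(1)]
    unfolding Y_def by auto
  have "Y = F \<or> Suc r \<le> card Y"
  proof (cases "Y = X")
    case True
    then show ?thesis using tp X(1,2) Y unfolding transitive_pair_def by blast
  next
    case False
    then have "card X < card Y"
      using Y fin by (intro psubset_card_mono) (auto intro: finite_subset)
    then show ?thesis using X(2) Y by auto
  qed
  then show "\<exists>X\<subseteq>F. X \<noteq> {} \<and> X \<subseteq> s ` {i. real i \<le> (N + 2) / b} \<and> p ` X \<subseteq> X \<and> (X = F \<or> Suc r \<le> card X)"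
    using X(2,3) Y unfolding Y_def[symmetric] by (metis subset_empty)
qed

lemma sees_all:
  assumes "transitive_pair F L p q" "sees F p q b N (card F)"
    "rotation_orbit F p q b s y c" "x \<in> F"
  obtains i where "real i \<le> N" "s i = x"
proof -
  obtain X where X: "X \<subseteq> F" "X \<subseteq> s ` {i. real i \<le> N}" "X = F \<or> card F \<le> card X"
    using assms(2)[unfolded sees_def, rule_format, OF assms(3)] by blast
  have "X = F"
    using X assms(1) unfolding transitive_pair_def by (metis card_seteq)
  then show ?thesis using X(2) assms(4) that by blast
qed

text \<open>At precision 1 all heights in the unit interval are close enough, so
  \<open>visits\<close> reduces to meeting each face with each branch.\<close>

definition sees_carry ::
  "'a set \<Rightarrow> ('a \<Rightarrow> 'a) \<Rightarrow> ('a \<Rightarrow> 'a) \<Rightarrow> real \<Rightarrow> real \<Rightarrow> bool \<Rightarrow> bool" where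
  "sees_carry F p q b N \<kappa> \<longleftrightarrow> (\<forall>s y c. rotation_orbit F p q b s y c \<longrightarrow>
     (\<forall>x\<in>F. \<exists>i. real i \<le> N \<and> s i = x \<and> c i = \<kappa>))"

text \<open>An induced visit to \<open>q x\<close> stems from a carry at \<open>x\<close>, because
  \<open>q\<close> is injective on \<open>F\<close>.\<close>

lemma sees_carry_True:
  assumes tp: "transitive_pair F L p q"
    and b: "0 < b" "1 / b = real a + \<theta>" and \<theta>: "0 < \<theta>" "\<theta> < 1" and a: "L dvd a" "1 \<le> a"
    and vis: "sees F q p \<theta> N (card F)"
  shows "sees_carry F p q b ((N + 2) / b) True"
  unfolding sees_carry_def
proof (intro allI impI ballI)
  fix s y c x assume orb: "rotation_orbit F p q b s y c" and x: "x \<in> F"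
  obtain T t z C where orb': "rotation_orbit F q p \<theta> t z C"
    and T: "\<And>n. 1 \<le> T n" "\<And>n. c (T n - 1)" "\<And>n. t n = q (s (T n - 1))"
    and time: "\<And>n j. j \<le> (if C n then a else a - 1) \<Longrightarrow> real (T n + j) \<le> (real n + 2) / b"
    using induced_orbit[OF tp orb b \<theta> a] by metis
  have bij: "bij_betw q F F" using tp by (simp add: transitive_pair_def)
  then obtain n where n: "real n \<le> N" "t n = q x"
    using sees_all[OF transitive_pair_swap[OF tp] vis orb', of "q x"] bij_betwE x by metis
  have "s (T n - 1) = x"
    using n(2) T(3)[of n] bij x rotation_orbitD(1)[OF orb] unfolding bij_betw_def
    by (metis inj_onD)
  moreover have "real (T n - 1) \<le> (N + 2) / b"
  proof -
    have "real (T n - 1) \<le> real (T n + 0)" by simp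
    also have "\<dots> \<le> (real n + 2) / b" by (rule time) simp
    also have "\<dots> \<le> (N + 2) / b" using n(1) b(1) by (simp add: field_simps)
    finally show ?thesis .
  qed
  ultimately show "\<exists>i. real i \<le> (N + 2) / b \<and> s i = x \<and> c i = True"
    using T(2) by blast
qed

text \<open>A long block starts with a step that is no carry, because \<open>a \<ge> 1\<close>; a
  short one with \<open>a = 1\<close> consists of its carry alone. This is why a carry of the
  induced orbit is asked for.\<close>

lemma sees_carry_False:
  assumes tp: "transitive_pair F L p q"
    and b: "0 < b" "1 / b = real a + \<theta>" and \<theta>: "0 < \<theta>" "\<theta> < 1" and a: "L dvd a" "1 \<le> a"
    and vis: "sees_carry F q p \<theta> N True"
  shows "sees_carry F p q b ((N + 2) / b) False"
  unfolding sees_carry_def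
proof (intro allI impI ballI)
  fix s y c x assume orb: "rotation_orbit F p q b s y c" and x: "x \<in> F"
  obtain T t z C where orb': "rotation_orbit F q p \<theta> t z C"
    and norun: "\<And>n j. j < (if C n then a else a - 1) \<Longrightarrow> \<not> c (T n + j)"
    and sTj: "\<And>n j. j \<le> (if C n then a else a - 1) \<Longrightarrow> s (T n + j) = (p ^^ Suc j) (t n)"
    and time: "\<And>n j. j \<le> (if C n then a else a - 1) \<Longrightarrow> real (T n + j) \<le> (real n + 2) / b"
    using induced_orbit[OF tp orb b \<theta> a] by metis
  obtain x' where x': "x' \<in> F" "p x' = x"
    using tp x unfolding transitive_pair_def bij_betw_def by (metis imageE)
  then obtain n where n: "real n \<le> N" "t n = x'" "C n"
    using vis[unfolded sees_carry_def, rule_format, OF orb'] by blast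
  have "\<not> c (T n)" "s (T n) = x"
    using norun[of 0 n] sTj[of 0 n] n x' a(2) by auto
  moreover have "real (T n) \<le> (N + 2) / b"
    using time[of 0 n] n(1) b(1) by (simp add: field_simps)
  ultimately show "\<exists>i. real i \<le> (N + 2) / b \<and> s i = x \<and> c i = False" by blast
qed

lemma visits_1:
  assumes "\<And>\<kappa>. sees_carry F p q b N \<kappa>"
  shows "visits F p q b N 1"
  unfolding visits_def
proof (intro allI impI ballI)
  fix s y c s0 \<kappa> and y0 :: real
  assume orb: "rotation_orbit F p q b s y c" and s0: "s0 \<in> F" and y0: "y0 \<in> {0..1}"
  obtain i where i: "real i \<le> N" "s i = s0" "c i = \<kappa>"
    using assms[of \<kappa>, unfolded sees_carry_def, rule_format, OF orb s0] by blast
  have "\<bar>y i - y0\<bar> \<le> 1"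
    using rotation_orbitD(2,3)[OF orb, of i] y0 by auto
  then show "\<exists>i. real i \<le> N \<and> s i = s0 \<and> c i = \<kappa> \<and> \<bar>y i - y0\<bar> \<le> 1"
    using i by blast
qed

lemma sees_mono:
  assumes "sees F p q b N r" "N \<le> N'"
  shows "sees F p q b N' r"
  unfolding sees_def
proof (intro allI impI)
  fix s y c assume orb: "rotation_orbit F p q b s y c"
  obtain X where X: "X \<subseteq> F" "X \<noteq> {}" "X \<subseteq> s ` {i. real i \<le> N}" "p ` X \<subseteq> X" "X = F \<or> r \<le> card X"
    using assms(1)[unfolded sees_def, rule_format, OF orb] by blast
  have "s ` {i. real i \<le> N} \<subseteq> s ` {i. real i \<le> N'}" using assms(2) by (intro image_mono) auto
  then show "\<exists>X\<subseteq>F. X \<noteq> {} \<and> X \<subseteq> s ` {i. real i \<le> N'} \<and> p ` X \<subseteq> X \<and> (X = F \<or> r \<le> card X)"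
    using X by (intro exI[of _ X]) auto
qed

lemma sees_carry_mono:
  assumes "sees_carry F p q b N \<kappa>" "N \<le> N'"
  shows "sees_carry F p q b N' \<kappa>"
  unfolding sees_carry_def
proof (intro allI impI ballI)
  fix s y c x assume "rotation_orbit F p q b s y c" "x \<in> F"
  from assms(1)[unfolded sees_carry_def, rule_format, OF this]
  show "\<exists>i. real i \<le> N' \<and> s i = x \<and> c i = \<kappa>"
    using assms(2) by force
qed

section \<open>Bounds uniform over the levels of renormalization\<close>

locale complete_quotients =
  fixes b :: "nat \<Rightarrow> real" and a :: "nat \<Rightarrow> nat" and L B :: nat
  assumes pos: "0 < b k" and less_1: "b k < 1"
    and recip: "1 / b k = real (a k) + b (Suc k)"
    and dvd_digit: "L dvd a k" and digit_pos: "1 \<le> a k" and digit_bound: "a k \<le> B"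
begin

lemmas level = pos[of k] recip[of k] pos[of "Suc k"] less_1[of "Suc k"] dvd_digit[of k] digit_pos[of k] for k

lemma recip_bound: "1 / b k \<le> real B + 1"
  using recip[of k] less_1[of "Suc k"] digit_bound[of k] by simp

lemma div_bound: "0 \<le> x \<Longrightarrow> x / b k \<le> x * (real B + 1)"
  using mult_left_mono[OF recip_bound[of k], of x] by simp

text \<open>The digit bound makes the next rotation number at least \<open>1 / (B + 1)\<close>, so
  \<open>1 / b k\<close> exceeds its digit, which is at least 1, by that much.\<close>

lemma away_from_1: "b k \<le> (real B + 1) / (real B + 2)"
proof -
  have "1 / (real B + 1) \<le> b (Suc k)"
    using recip_bound[of "Suc k"] pos[of "Suc k"] by (simp add: field_simps)
  then have "1 + 1 / (real B + 1) \<le> 1 / b k"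
    using recip[of k] digit_pos[of k] by simp
  then show ?thesis
    using pos[of k] by (simp add: field_simps)
qed

text \<open>\<open>N\<close> may depend on \<open>r\<close>, but on neither the level nor the pair:
  the induction step at level \<open>k\<close> uses level \<open>k + 1\<close> with the pair
  exchanged.\<close>

lemma sees_uniform:
  "\<exists>N\<ge>0. \<forall>k p q. transitive_pair F L p q \<longrightarrow> sees F p q (b k) N r"
proof (induction r)
  case 0
  have "sees F p q (b k) (2 * (real B + 1)) 0" if "transitive_pair F L p q" for p q :: "'a \<Rightarrow> 'a" and k
    by (rule sees_mono[OF sees_base[OF that level] div_bound]) simp
  then show ?case by (intro exI[of _ "2 * (real B + 1)"]) simp
next
  case (Suc r)
  then obtain N where N: "0 \<le> N"
    "\<And>k p q. transitive_pair F L p q \<Longrightarrow> sees F p q (b k) N r" by blast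
  have "sees F p q (b k) ((N + 2) * (real B + 1)) (Suc r)" if "transitive_pair F L p q" for p q and k
    by (rule sees_mono[OF sees_step[OF that level N(2)[OF transitive_pair_swap[OF that]]] div_bound])
      (use N(1) in simp)
  then show ?case using N(1) by (intro exI[of _ "(N + 2) * (real B + 1)"]) simp
qed

text \<open>Once all faces are seen, two more levels are spent: one to meet every face at a carry, a
  second to meet it at a step without carry.\<close>

lemma visits_uniform:
  "\<exists>N\<ge>0. \<forall>k p q. transitive_pair F L p q \<longrightarrow> visits F p q (b k) N 1"
proof -
  obtain N where N: "0 \<le> N"
    "\<And>k p q. transitive_pair F L p q \<Longrightarrow> sees F p q (b k) N (card F)"
    using sees_uniform[where F = F and r = "card F"] by blast
  define N1 where "N1 = (N + 2) * (real B + 1)"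
  define N2 where "N2 = (N1 + 2) * (real B + 1)"
  have N12: "0 \<le> N1" "N1 \<le> N2"
    using N(1) unfolding N1_def N2_def by (auto simp: algebra_simps)
  have T: "sees_carry F p q (b k) N1 True" if "transitive_pair F L p q" for p q k
    unfolding N1_def
    by (rule sees_carry_mono[OF sees_carry_True[OF that level N(2)[OF transitive_pair_swap[OF that]]] div_bound])
      (use N(1) in simp)
  have F: "sees_carry F p q (b k) N2 False" if "transitive_pair F L p q" for p q k
    unfolding N2_def
    by (rule sees_carry_mono[OF sees_carry_False[OF that level T[OF transitive_pair_swap[OF that]]] div_bound])
      (use N12 in simp)
  have "visits F p q (b k) N2 1" if tp: "transitive_pair F L p q" for p q k
  proof (rule visits_1)
    fix \<kappa> show "sees_carry F p q (b k) N2 \<kappa>"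
      using sees_carry_mono[OF T[OF tp] N12(2)] F[OF tp] by (cases \<kappa>) auto
  qed
  then show ?thesis using N12 by (intro exI[of _ N2]) auto
qed

text \<open>With \<open>c (1 - b k) \<ge> 2\<close>, the quantity \<open>(N + c) e\<close> does not increase under \<open>visits_step\<close>;
  this is what makes the number of steps linear in \<open>1 / e\<close>.\<close>

lemma visits_linear:
  assumes tp: "transitive_pair F L p q"
  obtains K where "0 \<le> K" "\<And>e. 0 < e \<Longrightarrow> e \<le> 1 \<Longrightarrow> visits F p q (b 0) (K / e) e"
proof -
  obtain N where N0: "0 \<le> N"
    and "\<forall>k p q. transitive_pair F L p q \<longrightarrow> visits F p q (b k) N 1"
    using visits_uniform[where F = F] by (elim exE conjE)
  note N = N0 this(2)[rule_format]
  \<comment> \<open>By \<open>away_from_1\<close>, \<open>1 - b k \<ge> 1 / (B + 2)\<close>, which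
    determines this value.\<close>
  define c where "c = 2 * (real B + 2)"
  have c: "c \<le> (c - 2) / b k" for k
    using away_from_1[of k] pos[of k] unfolding c_def by (simp add: field_simps)
  \<comment> \<open>The factor \<open>B + 1\<close> pays for the level at which the descent stops,
    where \<open>b k \<le> e\<close> and one step from precision 1 suffices.\<close>
  define K where "K = (N + c) * (real B + 1)"
  \<comment> \<open>A common upper bound of all \<open>b k\<close>: replacing \<open>e\<close> by
    \<open>e / b k\<close> lowers the exponent \<open>j\<close> by one, so the descent ends.\<close>
  define \<rho> where "\<rho> = (real B + 1) / (real B + 2)"
  have c0: "0 \<le> c" by (simp add: c_def)
  have "N + c \<le> K" using N(1) c0 unfolding K_def by (simp add: algebra_simps)
  have main: "visits F p q (b k) (K / e - c) e"
    if "transitive_pair F L p q" "0 < e" "\<rho> ^ j \<le> e" "e \<le> 1" for p q j k e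
    using that
  proof (induction j arbitrary: p q k e)
    case 0
    then have "e = 1" by simp
    then show ?case
      using visits_mono[OF N(2)[OF 0(1), of k], of "K / e - c" e] \<open>N + c \<le> K\<close> by simp
  next
    case (Suc j)
    have swap: "transitive_pair F L q p" using Suc.prems(1) by (rule transitive_pair_swap)
    note b = pos[of k]
    show ?case
    proof (cases "b k \<le> e")
      case True
      have "(N + 2) / b k + c \<le> (N + c) / b k"
        using c[of k] by (simp add: add_divide_distrib diff_divide_distrib)
      also have "\<dots> \<le> K"
        unfolding K_def by (rule div_bound) (use N(1) c0 in simp)
      also have "\<dots> \<le> K / e"
        using Suc.prems \<open>N + c \<le> K\<close> N(1) c0 by (simp add: field_simps mult_left_le)
      finally show ?thesis
        using visits_mono[OF visits_step[OF Suc.prems(1) level[of k] N(2)[OF swap]], of "K / e - c" e] True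
        by simp
    next
      case False
      define e' where "e' = e / b k"
      have e': "0 < e'" "e' \<le> 1" "e' * b k = e"
        using False Suc.prems b by (simp_all add: e'_def)
      have "\<rho> ^ j * b k \<le> \<rho> ^ j * \<rho>"
        using away_from_1[of k] by (intro mult_left_mono) (simp_all add: \<rho>_def)
      also have "\<dots> \<le> e' * b k" using Suc.prems(3) e' by (simp add: mult.commute)
      finally have "\<rho> ^ j \<le> e'" using b by simp
      from visits_step[OF Suc.prems(1) level[of k] Suc.IH[OF swap e'(1) this e'(2)]]
      have "visits F p q (b k) ((K / e' - c + 2) / b k) e" using e'(3) by simp
      moreover have "(K / e' - c + 2) / b k = K / e - (c - 2) / b k"
        using b by (simp add: e'_def diff_divide_distrib add_divide_distrib)
      ultimately show ?thesis using c[of k] visits_mono[of F p q "b k" _ e "K / e - c" e] by simp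
    qed
  qed
  have "visits F p q (b 0) (K / e) e" if e: "0 < e" "e \<le> 1" for e
  proof -
    have "\<rho> < 1" by (simp add: \<rho>_def)
    then obtain j where "\<rho> ^ j < e" using real_arch_pow_inv[OF e(1)] by blast
    then show ?thesis
      by (intro visits_mono[OF main[OF tp e(1) _ e(2), of j 0]]) (use c0 in simp_all)
  qed
  moreover have "0 \<le> K" using \<open>N + c \<le> K\<close> N(1) c0 by simp
  ultimately show ?thesis using that by blast
qed

end

section \<open>Continued fractions\<close>

lemma finite_cfrac_bounds:
  assumes "\<And>i. 1 \<le> a i"
  shows "1 \<le> finite_cfrac a n \<and> finite_cfrac a n \<le> of_int (a 0) + 1"
  using assms
proof (induction n arbitrary: a)
  case (Suc n)
  have "1 \<le> finite_cfrac (\<lambda>i. a (Suc i)) n"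
    using Suc.IH[of "\<lambda>i. a (Suc i)"] Suc.prems by simp
  moreover have "(1::real) \<le> of_int (a 0)" using Suc.prems[of 0] by simp
  ultimately show ?case by (simp add: add_increasing2)
qed simp

text \<open>Strict inequalities may be lost in the limit, so both come from explicit gaps: the tail
  is at most \<open>a 1 + 1\<close>, which keeps \<open>\<alpha> - a 0\<close> away from 0, and from
  its second approximant on the tail is at least \<open>1 + 1 / (a 2 + 1)\<close>, which keeps it
  away from 1.\<close>

lemma cfrac_expansion_unfold:
  assumes "cfrac_expansion \<alpha> a"
  shows "0 < \<alpha> - of_int (a 0)" "\<alpha> - of_int (a 0) < 1"
    "cfrac_expansion (1 / (\<alpha> - of_int (a 0))) (\<lambda>i. a (Suc i))"
proof -
  have a: "1 \<le> a (Suc i)" for i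
    using assms by (simp add: cfrac_expansion_def)
  have lim: "finite_cfrac a \<longlonglongrightarrow> \<alpha>"
    using assms by (simp add: cfrac_expansion_def)
  let ?f = "finite_cfrac (\<lambda>i. a (Suc i))"
  let ?g = "finite_cfrac (\<lambda>i. a (Suc (Suc i)))"
  have f: "1 \<le> ?f n" "?f n \<le> of_int (a 1) + 1" for n
    using finite_cfrac_bounds[of "\<lambda>i. a (Suc i)" n] a by simp_all
  have g: "1 \<le> ?g n" "?g n \<le> of_int (a 2) + 1" for n
    using finite_cfrac_bounds[of "\<lambda>i. a (Suc (Suc i))" n] a by (simp_all add: numeral_2_eq_2)
  have "(\<lambda>n. finite_cfrac a (Suc n) - of_int (a 0)) \<longlonglongrightarrow> \<alpha> - of_int (a 0)"
    using LIMSEQ_Suc[OF lim] by (intro tendsto_diff tendsto_const)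
  then have inv: "(\<lambda>n. 1 / ?f n) \<longlonglongrightarrow> \<alpha> - of_int (a 0)" by simp
  have "1 / (of_int (a 1) + 1) \<le> \<alpha> - of_int (a 0)"
  proof (rule LIMSEQ_le_const[OF inv], intro exI allI impI)
    fix n show "1 / (of_int (a 1) + 1) \<le> 1 / ?f n"
      using f[of n] by (intro divide_left_mono) auto
  qed
  moreover have "0 < 1 / (of_int (a 1) + 1 :: real)" using a[of 0] by simp
  ultimately show pos: "0 < \<alpha> - of_int (a 0)" by linarith
  have "(\<lambda>n. 1 / (1 / ?f n)) \<longlonglongrightarrow> 1 / (\<alpha> - of_int (a 0))"
    using pos by (intro tendsto_divide tendsto_const inv) simp
  then have lim1: "?f \<longlonglongrightarrow> 1 / (\<alpha> - of_int (a 0))" by simp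
  then show "cfrac_expansion (1 / (\<alpha> - of_int (a 0))) (\<lambda>i. a (Suc i))"
    using a by (simp add: cfrac_expansion_def)
  have "1 + 1 / (of_int (a 2) + 1) \<le> 1 / (\<alpha> - of_int (a 0))"
  proof (rule LIMSEQ_le_const[OF LIMSEQ_Suc[OF lim1]], intro exI allI impI)
    fix n
    have "1 / (of_int (a 2) + 1) \<le> 1 / ?g n"
      using g[of n] by (intro divide_left_mono) auto
    then show "1 + 1 / (of_int (a 2) + 1) \<le> ?f (Suc n)"
      using a[of 0] by simp
  qed
  moreover have "0 < 1 / (of_int (a 2) + 1 :: real)" using a[of 1] by (simp add: numeral_2_eq_2)
  ultimately have "1 < 1 / (\<alpha> - of_int (a 0))" by linarith
  then show "\<alpha> - of_int (a 0) < 1" using pos by (simp add: field_simps)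
qed

lemma cfrac_expansion_head:
  assumes "cfrac_expansion \<alpha> a"
  shows "a 0 = \<lfloor>\<alpha>\<rfloor>"
  using cfrac_expansion_unfold(1,2)[OF assms] by linarith

text \<open>Carries the digit bound, which \<open>badly_approximable\<close> grants for some
  expansion, over to the expansion whose digits are divisible by the street-LCM.\<close>

lemma cfrac_expansion_unique:
  assumes "cfrac_expansion \<alpha> a" "cfrac_expansion \<alpha> a'"
  shows "a i = a' i"
  using assms
proof (induction i arbitrary: \<alpha> a a')
  case 0
  then show ?case by (simp add: cfrac_expansion_head)
next
  case (Suc i)
  have "a 0 = a' 0" using Suc.prems by (simp add: cfrac_expansion_head)
  then show ?case
    using Suc.IH[OF cfrac_expansion_unfold(3)[OF Suc.prems(1)]] cfrac_expansion_unfold(3)[OF Suc.prems(2)]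
    by simp
qed

text \<open>Passing to the next complete quotient replaces a denominator by a smaller one.\<close>

lemma cfrac_expansion_irrational:
  assumes "cfrac_expansion \<alpha> a" "0 < Q"
  shows "\<alpha> * real Q \<noteq> of_int P"
  using assms
proof (induction Q arbitrary: \<alpha> a P rule: less_induct)
  case (less Q)
  show ?case
  proof
    assume eq: "\<alpha> * real Q = of_int P"
    define \<beta> where "\<beta> = \<alpha> - of_int (a 0)"
    have \<beta>: "0 < \<beta>" "\<beta> < 1" "cfrac_expansion (1 / \<beta>) (\<lambda>i. a (Suc i))"
      using cfrac_expansion_unfold[OF less.prems(1)] by (simp_all add: \<beta>_def)
    have "\<beta> * real Q = of_int (P - a 0 * int Q)"
      using eq by (simp add: \<beta>_def algebra_simps)
    moreover have "0 < \<beta> * real Q" "\<beta> * real Q < real Q"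
      using \<beta> less.prems(2) by simp_all
    ultimately obtain Q' :: nat where Q': "\<beta> * real Q = real Q'" "0 < Q'" "Q' < Q"
      by (metis of_int_0_less_iff of_int_of_nat_eq of_nat_less_iff of_nat_0_less_iff zero_less_imp_eq_int)
    have "1 / \<beta> * real Q' = of_int (int Q)"
      using Q'(1) \<beta>(1) by (simp add: field_simps)
    then show False
      using less.IH[OF Q'(3) \<beta>(3) Q'(2)] by blast
  qed
qed

section \<open>Polysquare surfaces\<close>

text \<open>Injectivity lets any coincidence of two iterates be cancelled down to a return to
  \<open>s\<close>, so the orbit is a pure cycle and its size is the least return time.\<close>

lemma funpow_card_orbit:
  assumes "finite F" "inj_on f F" "f ` F \<subseteq> F" "s \<in> F"
  shows "(f ^^ card (range (\<lambda>k. (f ^^ k) s))) s = s"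
proof -
  have mem: "(f ^^ k) s \<in> F" for k
    using assms(3,4) by (induction k) auto
  have cancel: "(f ^^ d) s = s" if "(f ^^ (k + d)) s = (f ^^ k) s" for k d
    using that
  proof (induction k)
    case (Suc k)
    then show ?case using assms(2) mem by (auto dest: inj_onD)
  qed simp
  have "\<not> inj (\<lambda>k. (f ^^ k) s)"
    using assms(1) mem by (metis finite_imageD finite_subset image_subset_iff infinite_UNIV_nat)
  then obtain i j where "i < j" "(f ^^ i) s = (f ^^ j) s"
    unfolding inj_def by (metis linorder_neqE_nat)
  then have "(f ^^ (j - i)) s = s" "0 < j - i" using cancel[of i "j - i"] by simp_all
  then have ex: "\<exists>d. 0 < d \<and> (f ^^ d) s = s" by blast
  define d where "d = (LEAST d. 0 < d \<and> (f ^^ d) s = s)"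
  have d: "0 < d" "(f ^^ d) s = s" using LeastI_ex[OF ex] by (auto simp: d_def)
  have least: "(f ^^ k) s \<noteq> s" if "0 < k" "k < d" for k
    using not_less_Least[of k "\<lambda>d. 0 < d \<and> (f ^^ d) s = s"] that by (auto simp: d_def)
  have "range (\<lambda>k. (f ^^ k) s) = (\<lambda>k. (f ^^ k) s) ` {..<d}"
  proof (intro equalityI subsetI)
    fix x assume "x \<in> range (\<lambda>k. (f ^^ k) s)"
    then obtain k where "x = (f ^^ (k mod d)) s" using funpow_mod_eq[OF d(2)] by auto
    then show "x \<in> (\<lambda>k. (f ^^ k) s) ` {..<d}" using d(1) by auto
  qed auto
  moreover have "inj_on (\<lambda>k. (f ^^ k) s) {..<d}"
  proof (rule linorder_inj_onI')
    fix i j assume "i \<in> {..<d}" "j \<in> {..<d}" "i < j"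
    then show "(f ^^ i) s \<noteq> (f ^^ j) s"
      using cancel[of i "j - i"] least[of "j - i"] by auto
  qed
  ultimately have "card (range (\<lambda>k. (f ^^ k) s)) = d" by (simp add: card_image)
  then show ?thesis using d(2) by simp
qed

lemma opposite_opposite [simp]: "opposite (opposite d) = d"
  by (cases d) auto

lemma step_opposite [simp]: "step (opposite d) (step d s) = s"
  by (cases d; cases s) auto

text \<open>Congruence modulo integer vectors. Gluing moves a local point by such a vector, so every
  surface point has a well-defined image on the torus.\<close>

definition cong_int :: "real \<times> real \<Rightarrow> real \<times> real \<Rightarrow> bool" where
  "cong_int p q \<longleftrightarrow> fst p - fst q \<in> \<int> \<and> snd p - snd q \<in> \<int>"

lemma cong_int_trans: "cong_int p q \<Longrightarrow> cong_int q r \<Longrightarrow> cong_int p r"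
  unfolding cong_int_def using Ints_add by fastforce

locale polysquare_surface =
  fixes F :: "face set" and \<sigma> :: "face \<times> side \<Rightarrow> face \<times> side"
  assumes surface: "polysquare_translation_surface F \<sigma>"
begin

lemma neighbour_opposite:
  assumes "s \<in> F"
  shows "neighbour F \<sigma> d s \<in> F" "neighbour F \<sigma> (opposite d) (neighbour F \<sigma> d s) = s"
proof -
  have "neighbour F \<sigma> d s \<in> F \<and> neighbour F \<sigma> (opposite d) (neighbour F \<sigma> d s) = s"
  proof (cases "step d s \<in> F")
    case True
    then show ?thesis using assms by (simp add: neighbour_def)
  next
    case False
    then have bd: "(s, d) \<in> boundary_edges F" using assms by (simp add: boundary_edges_def)
    then have "\<sigma> (s, d) \<in> boundary_edges F" "\<sigma> (\<sigma> (s, d)) = (s, d)" "snd (\<sigma> (s, d)) = opposite d"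
      using surface by (auto simp: polysquare_translation_surface_def edge_pairing_def)
    then show ?thesis using False
      by (cases "\<sigma> (s, d)") (auto simp: neighbour_def boundary_edges_def)
  qed
  then show "neighbour F \<sigma> d s \<in> F" "neighbour F \<sigma> (opposite d) (neighbour F \<sigma> d s) = s"
    by auto
qed

lemma finite_F: "finite F" and F_nonempty: "F \<noteq> {}"
  using surface by (simp_all add: polysquare_translation_surface_def polysquare_region_def)

lemma bij_neighbour: "bij_betw (neighbour F \<sigma> d) F F"
  by (rule bij_betwI[where g = "neighbour F \<sigma> (opposite d)"])
    (use neighbour_opposite neighbour_opposite[of _ "opposite d"] in auto)

abbreviation "east \<equiv> neighbour F \<sigma> East"
abbreviation "north \<equiv> neighbour F \<sigma> North"
abbreviation "L \<equiv> street_LCM F \<sigma>"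

lemma neighbour_funpow_L:
  assumes "s \<in> F" "d = East \<or> d = North"
  shows "(neighbour F \<sigma> d ^^ L) s = s"
proof -
  have fixed: "(neighbour F \<sigma> d ^^ card (range (\<lambda>k. (neighbour F \<sigma> d ^^ k) s))) s = s"
    using bij_neighbour[of d] by (intro funpow_card_orbit[OF finite_F _ _ assms(1)]) (auto simp: bij_betw_def)
  have "card (range (\<lambda>k. (neighbour F \<sigma> d ^^ k) s)) dvd L"
    unfolding street_LCM_def horizontal_street_def vertical_street_def
    using assms by (intro dvd_Lcm) auto
  then show ?thesis using funpow_mult_fixed[OF fixed] by (auto simp: dvd_def)
qed

lemma L_pos: "0 < L"
proof -
  have fin: "finite (range (\<lambda>k. (neighbour F \<sigma> d ^^ k) s))" if "s \<in> F" for d s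
  proof (rule finite_subset[OF _ finite_F])
    have "(neighbour F \<sigma> d ^^ k) s \<in> F" for k
      using that by (induction k) (auto intro: neighbour_opposite)
    then show "range (\<lambda>k. (neighbour F \<sigma> d ^^ k) s) \<subseteq> F" by auto
  qed
  have "0 \<notin> card ` (horizontal_street F \<sigma> ` F \<union> vertical_street F \<sigma> ` F)"
    using fin by (auto simp: horizontal_street_def vertical_street_def card_eq_0_iff image_iff)
  then have "L \<noteq> 0"
    unfolding street_LCM_def using finite_F by (subst Lcm_0_iff) auto
  then show ?thesis by simp
qed

lemma transitive_pair: "transitive_pair F L east north"
  unfolding transitive_pair_def
proof (intro conjI ballI allI impI)
  fix X assume X: "X \<subseteq> F" "X \<noteq> {}" "east ` X \<subseteq> X" "north ` X \<subseteq> X"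
  \<comment> \<open>An injective self-map of a finite set is onto, so closure under
    \<open>east\<close> and \<open>north\<close> entails closure under the neighbours to the west
    and south; then chains of adjacent faces can be followed.\<close>
  have onto: "neighbour F \<sigma> d ` X = X" if "neighbour F \<sigma> d ` X \<subseteq> X" for d
    using that X(1) bij_neighbour[of d] finite_F
    by (intro endo_inj_surj) (auto simp: bij_betw_def intro: finite_subset inj_on_subset)
  have inverse_closed: "neighbour F \<sigma> (opposite d) s \<in> X" if sub: "neighbour F \<sigma> d ` X \<subseteq> X" and mem: "s \<in> X" for d s
  proof -
    obtain r where "r \<in> X" "s = neighbour F \<sigma> d r" using onto[OF sub] mem by blast
    then show ?thesis using X(1) neighbour_opposite(2)[of r d] by auto
  qed
  have closed: "neighbour F \<sigma> d s \<in> X" if "s \<in> X" for d s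
    using inverse_closed[of East s] inverse_closed[of North s] that X(3,4) by (cases d) auto
  obtain s where s: "s \<in> X" using X(2) by blast
  have "t \<in> X" if "t \<in> F" for t
  proof -
    have "(s, t) \<in> {(s, t). s \<in> F \<and> t \<in> F \<and> (\<exists>d. t = step d s)}\<^sup>*"
      using surface s X(1) that
      by (auto simp: polysquare_translation_surface_def polysquare_region_def)
    then show ?thesis
    proof induction
      case (step t u)
      then obtain d where "u = step d t" "u \<in> F" by blast
      then have "u = neighbour F \<sigma> d t" by (simp add: neighbour_def)
      then show ?case using closed step.IH by blast
    qed (rule s)
  qed
  then show "X = F" using X(1) by blast
qed (use finite_F F_nonempty bij_neighbour neighbour_funpow_L in auto)

text \<open>Negative powers come for free, because \<open>north ^^ L\<close> is the identity.\<close>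

definition north_power :: "int \<Rightarrow> face \<Rightarrow> face" where
  "north_power m = north ^^ nat (m mod int L)"

lemma north_power_mem: "s \<in> F \<Longrightarrow> north_power m s \<in> F"
  using bij_betw_funpow[OF bij_neighbour] unfolding north_power_def bij_betw_def by blast

lemma north_power_0 [simp]: "north_power 0 s = s"
  by (simp add: north_power_def)

lemma north_power_add:
  assumes "s \<in> F"
  shows "north_power (m + n) s = north_power m (north_power n s)"
proof -
  define M N where "M = nat (m mod int L)" and "N = nat (n mod int L)"
  have "nat ((m + n) mod int L) = (M + N) mod L"
  proof -
    have "int (M + N) = m mod int L + n mod int L" using L_pos by (simp add: M_def N_def)
    then have "(m + n) mod int L = int ((M + N) mod L)"
      by (simp add: zmod_int mod_add_eq)
    then show ?thesis by simp
  qed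
  then show ?thesis
    using funpow_mod_eq[of L north s "M + N"] neighbour_funpow_L[OF assms]
    by (simp add: north_power_def M_def N_def funpow_add)
qed

lemma north_power_1:
  assumes "s \<in> F"
  shows "north_power 1 s = north s"
proof -
  have "(north ^^ (1 mod L)) s = (north ^^ 1) s"
    using funpow_mod_eq[of L north s 1] neighbour_funpow_L[OF assms] by blast
  moreover have "nat (1 mod int L) = 1 mod L" by (metis nat_int of_nat_1 zmod_int)
  ultimately show ?thesis by (simp add: north_power_def)
qed

lemma north_power_Suc: "s \<in> F \<Longrightarrow> north_power (m + 1) s = north (north_power m s)"
  using north_power_add[of s 1 m] north_power_1[OF north_power_mem] by (simp add: add.commute)

lemma north_power_mult: "int L dvd k \<Longrightarrow> north_power (k + m) s = north_power m s"
  by (auto simp: north_power_def dvd_def)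

section \<open>Points of the glued surface\<close>

lemma glue_east: "s \<in> F \<Longrightarrow> 0 \<le> y \<Longrightarrow> y \<le> 1 \<Longrightarrow> ((s, (1, y)), (east s, (0, y))) \<in> glue F \<sigma>"
  unfolding glue_def by (rule UnI1, rule CollectI, intro exI[of _ s] exI[of _ y]) simp

lemma glue_north: "s \<in> F \<Longrightarrow> 0 \<le> x \<Longrightarrow> x \<le> 1 \<Longrightarrow> ((s, (x, 1)), (north s, (x, 0))) \<in> glue F \<sigma>"
  unfolding glue_def by (rule UnI2, rule CollectI, intro exI[of _ s] exI[of _ x]) simp

lemma equiv_glue: "equiv UNIV (glue_equiv F \<sigma>)"
  unfolding glue_equiv_def
  by (intro equivI refl_rtrancl sym_rtrancl trans_rtrancl) (auto simp: sym_def)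

lemma surface_point_self: "(s, p) \<in> surface_point F \<sigma> s p"
  by (simp add: surface_point_def glue_equiv_def)

lemma surface_point_eqI: "(s', p') \<in> surface_point F \<sigma> s p \<Longrightarrow> surface_point F \<sigma> s' p' = surface_point F \<sigma> s p"
  unfolding surface_point_def using equiv_class_eq[OF equiv_glue] by blast

lemma surface_point_induct [consumes 1, case_names self glued unglued]:
  assumes "x' \<in> surface_point F \<sigma> s p" "Q (s, p)"
    "\<And>x y. (x, y) \<in> glue F \<sigma> \<Longrightarrow> Q x \<Longrightarrow> Q y"
    "\<And>x y. (x, y) \<in> glue F \<sigma> \<Longrightarrow> Q y \<Longrightarrow> Q x"
  shows "Q x'"
proof -
  have "((s, p), x') \<in> (glue F \<sigma> \<union> (glue F \<sigma>)\<inverse>)\<^sup>*"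
    using assms(1) by (simp add: surface_point_def glue_equiv_def)
  then show ?thesis by induction (use assms(2-) in auto)
qed

lemma surfaceE:
  assumes "X \<in> surface F \<sigma>"
  obtains s x y where "s \<in> F" "0 \<le> x" "x \<le> 1" "0 \<le> y" "y \<le> 1" "X = surface_point F \<sigma> s (x, y)"
proof -
  obtain a where "a \<in> F \<times> unit_square" "X = glue_equiv F \<sigma> `` {a}"
    using assms unfolding surface_def by (rule quotientE)
  then show ?thesis
    using that[of "fst a" "fst (snd a)" "snd (snd a)"]
    by (cases a) (auto simp: unit_square_def surface_point_def)
qed

lemma surface_pointI: "s \<in> F \<Longrightarrow> p \<in> unit_square \<Longrightarrow> surface_point F \<sigma> s p \<in> surface F \<sigma>"
  by (auto simp: surface_def surface_point_def intro!: quotientI)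

lemma surface_mem:
  assumes "X \<in> surface F \<sigma>" "(s, p) \<in> X"
  shows "X = surface_point F \<sigma> s p" "s \<in> F"
proof -
  obtain s0 p0 where X: "s0 \<in> F" "X = surface_point F \<sigma> s0 p0"
    using surfaceE[OF assms(1)] by metis
  then show "X = surface_point F \<sigma> s p" using assms(2) surface_point_eqI by blast
  have "(s, p) \<in> surface_point F \<sigma> s0 p0" using assms(2) X by simp
  then have "fst (s, p) \<in> F"
    by (induction rule: surface_point_induct) (use X neighbour_opposite in \<open>auto simp: glue_def\<close>)
  then show "s \<in> F" by simp
qed

text \<open>\<open>col s x y\<close> is the point at \<open>(x, y)\<close> of the vertical street of \<open>s\<close>, unrolled so that
  the real height \<open>y\<close> is measured from the bottom of \<open>s\<close>.\<close>

definition col :: "face \<Rightarrow> real \<Rightarrow> real \<Rightarrow> local_point set" where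
  "col s x y = surface_point F \<sigma> (north_power \<lfloor>y\<rfloor> s) (x, frac y)"

text \<open>At an integer height two values of \<open>m\<close> are allowed; they describe the two
  sides of one glued horizontal edge.\<close>

lemma col_eq:
  assumes "s \<in> F" "0 \<le> x" "x \<le> 1" "0 \<le> y - of_int m" "y - of_int m \<le> 1"
  shows "col s x y = surface_point F \<sigma> (north_power m s) (x, y - of_int m)"
proof (cases "y = of_int m + 1")
  case False
  then have "\<lfloor>y\<rfloor> = m" using assms by linarith
  then show ?thesis by (simp add: col_def frac_def)
next
  case True
  have "((north_power m s, (x, 1)), (north_power (m + 1) s, (x, 0))) \<in> glue F \<sigma>"
    using glue_north[OF north_power_mem[OF assms(1)] assms(2,3)] assms(1) by (simp add: north_power_Suc)
  then have "(north_power (m + 1) s, (x, 0)) \<in> surface_point F \<sigma> (north_power m s) (x, 1)"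
    by (auto simp: surface_point_def glue_equiv_def)
  moreover have "\<lfloor>y\<rfloor> = m + 1" using True by linarith
  ultimately show ?thesis using surface_point_eqI True by (simp add: col_def frac_def)
qed

lemma col_0: "s \<in> F \<Longrightarrow> 0 \<le> x \<Longrightarrow> x \<le> 1 \<Longrightarrow> 0 \<le> y \<Longrightarrow> y \<le> 1 \<Longrightarrow> col s x y = surface_point F \<sigma> s (x, y)"
  using col_eq[of s x y 0] by simp

lemma col_surface: "s \<in> F \<Longrightarrow> 0 \<le> x \<Longrightarrow> x \<le> 1 \<Longrightarrow> col s x y \<in> surface F \<sigma>"
  unfolding col_def by (intro surface_pointI north_power_mem)
    (auto simp: unit_square_def frac_ge_0 frac_lt_1 less_imp_le)

lemma col_north_power: "s \<in> F \<Longrightarrow> col (north_power k s) x y = col s x (y + of_int k)"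
  by (simp add: col_def north_power_add frac_def)

lemma col_east:
  assumes "s \<in> F"
  shows "col s 1 y = col (east (north_power \<lfloor>y\<rfloor> s)) 0 (frac y)"
proof -
  define s' where "s' = north_power \<lfloor>y\<rfloor> s"
  have s': "s' \<in> F" using assms by (simp add: s'_def north_power_mem)
  have fy: "0 \<le> frac y" "frac y \<le> 1" by (auto simp: frac_lt_1 less_imp_le)
  then have "((s', (1, frac y)), (east s', (0, frac y))) \<in> glue F \<sigma>"
    using s' by (intro glue_east)
  then have "(east s', (0, frac y)) \<in> surface_point F \<sigma> s' (1, frac y)"
    by (auto simp: surface_point_def glue_equiv_def)
  then have "surface_point F \<sigma> (east s') (0, frac y) = col s 1 y"
    using surface_point_eqI by (simp add: col_def s'_def)
  then show ?thesis
    using col_0[of "east s'" 0 "frac y"] neighbour_opposite(1)[OF s'] fy by (simp add: s'_def)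
qed

text \<open>Strictly between the vertical edges only the gluings of horizontal edges apply, and
  these stay in the column. Going down uses injectivity of \<open>north\<close>.\<close>

lemma col_mem:
  assumes "(s', p') \<in> col s x y" "s \<in> F" "0 < x" "x < 1"
  obtains m where "s' = north_power m s" "p' = (x, y - of_int m)"
    "0 \<le> y - of_int m" "y - of_int m \<le> 1"
proof -
  define Q where "Q a \<longleftrightarrow> (\<exists>m. fst a = north_power m s \<and> snd a = (x, y - of_int m) \<and>
    0 \<le> y - of_int m \<and> y - of_int m \<le> 1)" for a
  have "Q (s', p')" using assms(1) unfolding col_def
  proof (induction rule: surface_point_induct)
    case self
    show ?case unfolding Q_def
      by (intro exI[of _ "\<lfloor>y\<rfloor>"]) (simp add: frac_def, linarith)
  next
    case (glued a a')
    obtain m where m: "fst a = north_power m s" "snd a = (x, y - of_int m)"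
      using glued(2) by (auto simp: Q_def)
    then have "y - of_int m = 1" "a' = (north (north_power m s), (x, 0))"
      using glued(1) assms(3,4) by (auto simp: glue_def)
    then show ?case unfolding Q_def
      by (intro exI[of _ "m + 1"]) (simp add: north_power_Suc assms(2))
  next
    case (unglued a a')
    obtain m where m: "fst a' = north_power m s" "snd a' = (x, y - of_int m)"
      using unglued(2) by (auto simp: Q_def)
    then have a: "y - of_int m = 0" "snd a = (x, 1)" "fst a \<in> F" "north (fst a) = north_power m s"
      using unglued(1) assms(3,4) by (auto simp: glue_def)
    have "north (north_power (m - 1) s) = north_power m s"
      using north_power_Suc[OF assms(2), of "m - 1"] by simp
    then have "fst a = north_power (m - 1) s"
      using a bij_neighbour[of North] north_power_mem[OF assms(2)] unfolding bij_betw_def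
      by (metis inj_onD)
    then show ?case unfolding Q_def
      using a by (intro exI[of _ "m - 1"]) simp
  qed
  then show ?thesis using that by (auto simp: Q_def)
qed

text \<open>An interior point of a vertical edge has just two representatives. The one on the far
  side has first coordinate 1, which is impossible for a piece that continues to the right.\<close>

lemma edge_mem:
  assumes "(s', p') \<in> surface_point F \<sigma> s (0, y)" "0 < y" "y < 1"
  shows "s' = s \<and> p' = (0, y) \<or> fst p' = 1"
proof -
  define Q :: "local_point \<Rightarrow> bool" where "Q a \<longleftrightarrow> a = (s, (0, y)) \<or> (fst a \<in> F \<and> east (fst a) = s \<and> snd a = (1, y))" for a
  have "Q (s', p')" using assms(1)
    by (induction rule: surface_point_induct) (use assms(2,3) in \<open>auto simp: Q_def glue_def\<close>)
  then show ?thesis by (auto simp: Q_def)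
qed

lemma surface_point_cong_int:
  assumes "(s', p') \<in> surface_point F \<sigma> s p"
  shows "cong_int p' p"
proof -
  have "cong_int (snd (s', p')) p" using assms
  proof (induction rule: surface_point_induct)
    case (glued a a')
    then have "cong_int (snd a') (snd a)" by (auto simp: glue_def cong_int_def)
    then show ?case using glued cong_int_trans by blast
  next
    case (unglued a a')
    then have "cong_int (snd a) (snd a')" by (auto simp: glue_def cong_int_def)
    then show ?case using unglued cong_int_trans by blast
  qed (simp add: cong_int_def)
  then show ?thesis by simp
qed

section \<open>Upper bounds for the flat distance\<close>

lemma broken_line_nonneg: "broken_line F \<sigma> X Y l \<Longrightarrow> 0 \<le> l"
  by (induction rule: broken_line.induct) auto

lemma surface_dist_le: "broken_line F \<sigma> X Y l \<Longrightarrow> surface_dist F \<sigma> X Y \<le> l"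
  unfolding surface_dist_def by (intro cInf_lower) (auto intro!: bdd_belowI[of _ 0] broken_line_nonneg)

lemma broken_line_col:
  assumes "broken_line F \<sigma> X (col s x y) l" "s \<in> F" "0 \<le> x" "x \<le> 1"
    "{y, y'} \<subseteq> {of_int m..of_int m + 1}"
  shows "broken_line F \<sigma> X (col s x y') (l + \<bar>y - y'\<bar>)"
proof -
  have "(north_power m s, (x, y - of_int m)) \<in> col s x y"
    using col_eq[of s x y m] assms(2-) surface_point_self by simp
  from broken_line.segment[OF assms(1) this, of "(x, y' - of_int m)"]
  have "broken_line F \<sigma> X (surface_point F \<sigma> (north_power m s) (x, y' - of_int m)) (l + \<bar>y - y'\<bar>)"
    using assms(3-) by (simp add: unit_square_def dist_Pair_Pair dist_real_def)
  then show ?thesis using col_eq[of s x y' m] assms(2-) by simp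
qed

lemma surface_dist_col:
  assumes "s \<in> F" "0 \<le> x" "x \<le> 1" "\<bar>y - y'\<bar> \<le> 1"
  shows "surface_dist F \<sigma> (col s x y) (col s x y') \<le> \<bar>y - y'\<bar>"
proof -
  have start: "broken_line F \<sigma> (col s x y) (col s x y) 0"
    using broken_line.trivial col_surface assms by blast
  \<comment> \<open>The only integer height that can separate \<open>y\<close> from
    \<open>y'\<close>, as they differ by at most 1; if it does, the vertical segment is broken
    there.\<close>
  define M where "M = \<lfloor>max y y'\<rfloor>"
  show ?thesis
  proof (cases "of_int M \<le> min y y'")
    case True
    then have "{y, y'} \<subseteq> {of_int M..of_int M + 1}" unfolding M_def by (auto simp: max_def) linarith+
    then show ?thesis using surface_dist_le[OF broken_line_col[OF start assms(1-3)]] by simp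
  next
    case False
    define k where "k = (if y \<le> y' then M - 1 else M)"
    define k' where "k' = (if y \<le> y' then M else M - 1)"
    have M: "of_int M \<le> max y y'" "max y y' \<le> of_int M + 1" unfolding M_def by linarith+
    have "{y, of_int M} \<subseteq> {of_int k..of_int k + 1}" "{of_int M, y'} \<subseteq> {of_int k'..of_int k' + 1}"
      using M False assms(4) unfolding k_def k'_def by (auto simp: max_def min_def split: if_splits)
    then have "broken_line F \<sigma> (col s x y) (col s x y') (0 + \<bar>y - of_int M\<bar> + \<bar>of_int M - y'\<bar>)"
      using start assms(1-3) by (intro broken_line_col)
    moreover have "0 + \<bar>y - of_int M\<bar> + \<bar>of_int M - y'\<bar> = \<bar>y - y'\<bar>"
      using M False by (auto simp: max_def min_def split: if_splits)
    ultimately show ?thesis using surface_dist_le by metis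
  qed
qed

end

section \<open>Geodesics\<close>

text \<open>Bisection: near each point, \<open>bwd\<close> carries \<open>R\<close> from the left up
  to the point and \<open>fwd\<close> carries it beyond. The two hypotheses mirror the two
  straightness clauses of a geodesic, and \<open>bwd\<close> takes the place of closedness of
  \<open>R\<close>.\<close>

lemma real_segment_induct:
  fixes c d :: real
  assumes "R c" and fwd: "\<And>t. c \<le> t \<Longrightarrow> t < d \<Longrightarrow> R t \<Longrightarrow> \<exists>e>0. \<forall>h\<in>{0..e}. t + h \<le> d \<longrightarrow> R (t + h)"
    and bwd: "\<And>t. c < t \<Longrightarrow> t \<le> d \<Longrightarrow> \<exists>e>0. \<forall>h\<in>{0..e}. c \<le> t - h \<longrightarrow> R (t - h) \<longrightarrow> R t"
    and "c \<le> t" "t \<le> d"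
  shows "R t"
proof -
  \<comment> \<open>Vacuous outside \<open>[c, d]\<close>, as the small intervals of the bisection
    may stick out; when the left end does, \<open>R c\<close> starts the argument instead.\<close>
  define Q where "Q t \<longleftrightarrow> (c \<le> t \<and> t \<le> d \<longrightarrow> R t)" for t
  have "Q c \<longrightarrow> Q t"
  proof (rule Bolzano[OF \<open>c \<le> t\<close>])
    fix x assume x: "c \<le> x" "x \<le> t"
    obtain e1 where e1: "e1 > 0" "\<And>h. 0 \<le> h \<Longrightarrow> h \<le> e1 \<Longrightarrow> R x \<Longrightarrow> x + h \<le> d \<Longrightarrow> R (x + h)"
    proof (cases "x < d \<and> R x")
      case True
      then show ?thesis using fwd[of x] x that by fastforce
    next
      case False
      show ?thesis
      proof (rule that[of 1])
        fix h assume "0 \<le> h" "R x" "x + h \<le> d"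
        then have "h = 0" using False by linarith
        then show "R (x + h)" using \<open>R x\<close> by simp
      qed simp
    qed
    obtain e2 where e2: "e2 > 0" "\<And>h. 0 \<le> h \<Longrightarrow> h \<le> e2 \<Longrightarrow> c \<le> x - h \<Longrightarrow> R (x - h) \<Longrightarrow> R x"
    proof (cases "c < x")
      case True
      then show ?thesis using bwd[of x] x assms(5) that by fastforce
    next
      case False
      then show ?thesis using that[of 1] x \<open>R c\<close> by simp
    qed
    have "Q b" if "a \<le> x" "x \<le> b" "b - a < min e1 e2" "Q a" for a b
      unfolding Q_def
    proof
      assume b: "c \<le> b \<and> b \<le> d"
      have "R x"
      proof (cases "c \<le> a")
        case True
        then show ?thesis using e2(2)[of "x - a"] that b by (auto simp: Q_def)
      next
        case False
        then show ?thesis using e2(2)[of "x - c"] that x \<open>R c\<close> by simp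
      qed
      then show "R b" using e1(2)[of "b - x"] that b by simp
    qed
    then show "\<exists>d>0. \<forall>a b. a \<le> x \<and> x \<le> b \<and> b - a < d \<longrightarrow> (Q a \<longrightarrow> Q b)"
      using e1(1) e2(1) by (intro exI[of _ "min e1 e2"]) auto
  qed auto
  then show ?thesis using assms by (simp add: Q_def)
qed

locale polysquare_geodesic = polysquare_surface +
  fixes \<alpha> :: real and \<gamma> :: "real \<Rightarrow> local_point set"
  assumes geodesic: "half_infinite_geodesic F \<sigma> \<alpha> \<gamma>"
begin

text \<open>Horizontal speed: crossing a column of unit width takes time
  \<open>1 / w\<close>.\<close>

definition w :: real where "w = 1 / sqrt (1 + \<alpha>\<^sup>2)"

lemma w_pos: "0 < w"
  by (simp add: w_def add_pos_nonneg)

lemma unit_direction: "p + h *\<^sub>R unit_direction \<alpha> = (fst p + h * w, snd p + h * w * \<alpha>)"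
  "p - h *\<^sub>R unit_direction \<alpha> = (fst p - h * w, snd p - h * w * \<alpha>)"
  by (auto simp: unit_direction_def w_def prod_eq_iff)

lemma geodesic_surface: "0 \<le> t \<Longrightarrow> \<gamma> t \<in> surface F \<sigma>"
  using geodesic by (simp add: half_infinite_geodesic_def)

lemma geodesic_forward:
  assumes "0 \<le> t"
  obtains e s x y where "0 < e" "(s, (x, y)) \<in> \<gamma> t"
    "\<And>h. 0 \<le> h \<Longrightarrow> h \<le> e \<Longrightarrow> (x + h * w, y + h * w * \<alpha>) \<in> unit_square \<and>
      \<gamma> (t + h) = surface_point F \<sigma> s (x + h * w, y + h * w * \<alpha>)"
proof -
  have "\<exists>e>0. \<exists>(s, p)\<in>\<gamma> t. \<forall>h\<in>{0..e}. p + h *\<^sub>R unit_direction \<alpha> \<in> unit_square \<and>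
        \<gamma> (t + h) = surface_point F \<sigma> s (p + h *\<^sub>R unit_direction \<alpha>)"
    using geodesic assms unfolding half_infinite_geodesic_def by blast
  then obtain e s p where "0 < e" "(s, p) \<in> \<gamma> t" "\<forall>h\<in>{0..e}. p + h *\<^sub>R unit_direction \<alpha> \<in> unit_square \<and>
        \<gamma> (t + h) = surface_point F \<sigma> s (p + h *\<^sub>R unit_direction \<alpha>)" by blast
  then show ?thesis using that[of e s "fst p" "snd p"] by (simp add: unit_direction)
qed

lemma geodesic_backward:
  assumes "0 < t"
  obtains e s x y where "0 < e" "e \<le> t" "(s, (x, y)) \<in> \<gamma> t"
    "\<And>h. 0 \<le> h \<Longrightarrow> h \<le> e \<Longrightarrow> (x - h * w, y - h * w * \<alpha>) \<in> unit_square \<and>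
      \<gamma> (t - h) = surface_point F \<sigma> s (x - h * w, y - h * w * \<alpha>)"
proof -
  have "\<exists>e\<in>{0<..t}. \<exists>(s, p)\<in>\<gamma> t. \<forall>h\<in>{0..e}. p - h *\<^sub>R unit_direction \<alpha> \<in> unit_square \<and>
        \<gamma> (t - h) = surface_point F \<sigma> s (p - h *\<^sub>R unit_direction \<alpha>)"
    using geodesic assms unfolding half_infinite_geodesic_def by blast
  then obtain e s p where "e \<in> {0<..t}" "(s, p) \<in> \<gamma> t" "\<forall>h\<in>{0..e}. p - h *\<^sub>R unit_direction \<alpha> \<in> unit_square \<and>
        \<gamma> (t - h) = surface_point F \<sigma> s (p - h *\<^sub>R unit_direction \<alpha>)" by blast
  then show ?thesis using that[of e s "fst p" "snd p"] by (simp add: unit_direction)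
qed

lemma geodesic_cong_int:
  assumes "0 \<le> t" "(s, p) \<in> \<gamma> t" "(s', p') \<in> \<gamma> t"
  shows "cong_int p p'"
  using surface_point_cong_int[of s p s' p'] surface_mem(1)[OF geodesic_surface assms(3)] assms by simp

text \<open>Modulo integer vectors the geodesic is a straight line on the torus, whichever faces it
  runs through.\<close>

lemma geodesic_drift:
  assumes "0 \<le> t0" "(s0, (x0, y0)) \<in> \<gamma> t0" "t0 \<le> t"
  shows "\<exists>(s, p)\<in>\<gamma> t. cong_int p (x0 + (t - t0) * w, y0 + (t - t0) * w * \<alpha>)"
proof -
  define R where "R t \<longleftrightarrow> (\<exists>(s, p)\<in>\<gamma> t. cong_int p (x0 + (t - t0) * w, y0 + (t - t0) * w * \<alpha>))" for t
  have "R t"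
  proof (rule real_segment_induct[of R t0 t])
    show "R t0" unfolding R_def using assms(2) by (intro bexI[of _ "(s0, (x0, y0))"]) (simp_all add: cong_int_def)
  next
    fix t assume t: "t0 \<le> t" "R t"
    then have "0 \<le> t" using assms(1) by simp
    from geodesic_forward[OF this] obtain e s x y where e: "0 < e" "(s, (x, y)) \<in> \<gamma> t"
      and *: "\<And>h. 0 \<le> h \<Longrightarrow> h \<le> e \<Longrightarrow> \<gamma> (t + h) = surface_point F \<sigma> s (x + h * w, y + h * w * \<alpha>)" by metis
    obtain s' p' where "(s', p') \<in> \<gamma> t" "cong_int p' (x0 + (t - t0) * w, y0 + (t - t0) * w * \<alpha>)"
      using t(2) by (auto simp: R_def)
    then have c: "cong_int (x, y) (x0 + (t - t0) * w, y0 + (t - t0) * w * \<alpha>)"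
      using geodesic_cong_int[OF \<open>0 \<le> t\<close> e(2)] cong_int_trans by blast
    have "R (t + h)" if "h \<in> {0..e}" for h
    proof -
      have "(s, (x + h * w, y + h * w * \<alpha>)) \<in> \<gamma> (t + h)"
        using * that surface_point_self by simp
      moreover have "cong_int (x + h * w, y + h * w * \<alpha>) (x0 + (t + h - t0) * w, y0 + (t + h - t0) * w * \<alpha>)"
        using c by (simp add: cong_int_def algebra_simps)
      ultimately show ?thesis unfolding R_def by blast
    qed
    then show "\<exists>e>0. \<forall>h\<in>{0..e}. t + h \<le> d \<longrightarrow> R (t + h)" for d using e(1) by blast
  next
    fix t assume t: "t0 < t"
    then have "0 < t" using assms(1) by simp
    from geodesic_backward[OF this] obtain e s x y where e: "0 < e" "e \<le> t" "(s, (x, y)) \<in> \<gamma> t"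
      and *: "\<And>h. 0 \<le> h \<Longrightarrow> h \<le> e \<Longrightarrow> \<gamma> (t - h) = surface_point F \<sigma> s (x - h * w, y - h * w * \<alpha>)" by metis
    have "R t" if h: "h \<in> {0..e}" "R (t - h)" for h
    proof -
      have mem: "(s, (x - h * w, y - h * w * \<alpha>)) \<in> \<gamma> (t - h)"
        using * h surface_point_self by simp
      obtain s' p' where "(s', p') \<in> \<gamma> (t - h)"
        "cong_int p' (x0 + (t - h - t0) * w, y0 + (t - h - t0) * w * \<alpha>)"
        using h(2) by (auto simp: R_def)
      then have "cong_int (x - h * w, y - h * w * \<alpha>) (x0 + (t - h - t0) * w, y0 + (t - h - t0) * w * \<alpha>)"
        using geodesic_cong_int[OF _ mem] cong_int_trans h e(2) by (meson atLeastAtMost_iff diff_ge_0_iff_ge order_trans)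
      then have "cong_int (x, y) (x0 + (t - t0) * w, y0 + (t - t0) * w * \<alpha>)"
        by (simp add: cong_int_def algebra_simps)
      then show ?thesis using e(3) unfolding R_def by blast
    qed
    then show "\<exists>e>0. \<forall>h\<in>{0..e}. t0 \<le> t - h \<longrightarrow> R (t - h) \<longrightarrow> R t" using e(1) by blast
  qed (use assms in auto)
  then show ?thesis by (simp add: R_def)
qed

definition vertex :: "local_point set \<Rightarrow> bool" where
  "vertex X \<longleftrightarrow> (\<exists>(s, p)\<in>X. fst p \<in> \<int> \<and> snd p \<in> \<int>)"

text \<open>Between two vertex times both coordinates change by integers, and their quotient is the
  slope.\<close>

lemma eventually_no_vertex:
  assumes irrational: "\<alpha> \<notin> \<rat>"
  obtains t0 where "0 \<le> t0" "\<And>t. t0 \<le> t \<Longrightarrow> \<not> vertex (\<gamma> t)"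
proof (cases "\<exists>t\<ge>0. vertex (\<gamma> t)")
  case False
  then show ?thesis using that[of 0] by blast
next
  case True
  then obtain t1 s1 x1 y1 where t1: "0 \<le> t1" "(s1, (x1, y1)) \<in> \<gamma> t1" "x1 \<in> \<int>" "y1 \<in> \<int>"
    by (auto simp: vertex_def)
  \<comment> \<open>The delay of 1 makes the elapsed time positive, hence the horizontal change
    nonzero.\<close>
  have "\<not> vertex (\<gamma> t)" if "t1 + 1 \<le> t" for t
  proof
    assume "vertex (\<gamma> t)"
    then obtain s p where p: "(s, p) \<in> \<gamma> t" "fst p \<in> \<int>" "snd p \<in> \<int>" by (auto simp: vertex_def)
    obtain s' p' where p': "(s', p') \<in> \<gamma> t" "cong_int p' (x1 + (t - t1) * w, y1 + (t - t1) * w * \<alpha>)"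
      using geodesic_drift[OF t1(1,2), of t] \<open>t1 + 1 \<le> t\<close> by auto
    have "cong_int p (x1 + (t - t1) * w, y1 + (t - t1) * w * \<alpha>)"
      using cong_int_trans[OF geodesic_cong_int[OF _ p(1) p'(1)] p'(2)] \<open>t1 + 1 \<le> t\<close> t1(1) by simp
    then have "fst p - (x1 + (t - t1) * w) \<in> \<int>" "snd p - (y1 + (t - t1) * w * \<alpha>) \<in> \<int>"
      by (simp_all add: cong_int_def)
    then have "fst p - x1 - (fst p - (x1 + (t - t1) * w)) \<in> \<int>"
      "snd p - y1 - (snd p - (y1 + (t - t1) * w * \<alpha>)) \<in> \<int>"
      using p t1 by (blast intro: Ints_diff)+
    then have "(t - t1) * w \<in> \<rat>" "(t - t1) * w * \<alpha> \<in> \<rat>"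
      using Ints_subset_Rats by (auto simp: algebra_simps)
    then have "(t - t1) * w * \<alpha> / ((t - t1) * w) \<in> \<rat>" by (intro Rats_divide)
    moreover have "(t - t1) * w \<noteq> 0" using \<open>t1 + 1 \<le> t\<close> w_pos by simp
    ultimately show False using irrational by simp
  qed
  then show ?thesis using that[of "t1 + 1"] t1(1) by simp
qed

text \<open>Inside the column representatives differ only in the choice of \<open>m\<close>, so each
  straight piece continues the line. The delicate moment is a start on the left edge, where a
  representative could belong to the face to the west; away from vertices \<open>edge_mem\<close>
  settles it.\<close>

lemma column_crossing:
  assumes t0: "0 \<le> t0" and nv: "\<And>t. t0 \<le> t \<Longrightarrow> \<not> vertex (\<gamma> t)"
    and s: "s \<in> F" and x: "0 \<le> x" "x \<le> x'" "x' \<le> 1" and start: "\<gamma> t0 = col s x y"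
  shows "\<gamma> (t0 + (x' - x) / w) = col s x' (y + (x' - x) * \<alpha>)"
proof -
  define X Y where "X t = x + (t - t0) * w" and "Y t = y + (t - t0) * w * \<alpha>" for t
  define d where "d = t0 + (x' - x) / w"
  have Xd: "X d = x'" using w_pos by (simp add: X_def d_def)
  have mono: "X t < X t'" if "t < t'" for t t' using that w_pos by (simp add: X_def)
  have shift: "X (t + h) = X t + h * w" "Y (t + h) = Y t + h * w * \<alpha>"
    "X (t - h) = X t - h * w" "Y (t - h) = Y t - h * w * \<alpha>" for t h
    by (simp_all add: X_def Y_def algebra_simps)
  have Xt0: "X t0 = x" "Y t0 = y" by (simp_all add: X_def Y_def)
  have "\<gamma> d = col s (X d) (Y d)"
  proof (rule real_segment_induct[of "\<lambda>t. \<gamma> t = col s (X t) (Y t)" t0 d])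
    show "\<gamma> t0 = col s (X t0) (Y t0)" using start Xt0 by simp
  next
    fix t assume t: "t0 \<le> t" "t < d" and eq: "\<gamma> t = col s (X t) (Y t)"
    have "0 \<le> t" using t0 t by simp
    from geodesic_forward[OF this] obtain e s' p1 p2 where e: "0 < e" "(s', (p1, p2)) \<in> \<gamma> t"
      and *: "\<And>h. 0 \<le> h \<Longrightarrow> h \<le> e \<Longrightarrow> (p1 + h * w, p2 + h * w * \<alpha>) \<in> unit_square"
        "\<And>h. 0 \<le> h \<Longrightarrow> h \<le> e \<Longrightarrow> \<gamma> (t + h) = surface_point F \<sigma> s' (p1 + h * w, p2 + h * w * \<alpha>)" by metis
    have Xt: "X t < 1" using mono[OF t(2)] Xd x by simp
    obtain m where m: "s' = north_power m s" "(p1, p2) = (X t, Y t - of_int m)"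
    proof (cases "0 < X t")
      case True
      then show ?thesis using col_mem[of s' "(p1, p2)" s "X t" "Y t"] e(2) eq s Xt that by metis
    next
      case False
      then have "t = t0" "X t = 0" using mono[of t0 t] Xt0 x t by (cases "t = t0"; simp)+
      have g: "\<gamma> t = surface_point F \<sigma> (north_power \<lfloor>Y t\<rfloor> s) (0, frac (Y t))"
        using eq \<open>X t = 0\<close> by (simp add: col_def)
      have "frac (Y t) \<notin> \<int>"
        using nv[OF t(1)] surface_point_self[of "north_power \<lfloor>Y t\<rfloor> s" "(0, frac (Y t))"]
        unfolding g vertex_def by force
      then have "0 < frac (Y t)" using frac_ge_0[of "Y t"] Ints_0 by (metis order_le_less)
      then have "s' = north_power \<lfloor>Y t\<rfloor> s \<and> (p1, p2) = (0, frac (Y t)) \<or> fst (p1, p2) = 1"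
        using edge_mem[of s' "(p1, p2)"] e(2) g frac_lt_1 by metis
      \<comment> \<open>A piece starting on a right edge would leave the square at once.\<close>
      moreover have "p1 \<noteq> 1"
        using *(1)[of e] e(1) mult_pos_pos[OF e(1) w_pos] by (auto simp: unit_square_def)
      ultimately show ?thesis using that[of "\<lfloor>Y t\<rfloor>"] \<open>X t = 0\<close> by (simp add: frac_def)
    qed
    have "\<gamma> (t + h) = col s (X (t + h)) (Y (t + h))" if h: "h \<in> {0..e}" for h
    proof -
      have XY: "X (t + h) = p1 + h * w" "Y (t + h) - of_int m = p2 + h * w * \<alpha>"
        using m(2) shift(1,2)[of t h] by simp_all
      have "(X (t + h), Y (t + h) - of_int m) \<in> unit_square"
        "\<gamma> (t + h) = surface_point F \<sigma> (north_power m s) (X (t + h), Y (t + h) - of_int m)"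
        unfolding XY using *[of h] h m(1) by simp_all
      then show ?thesis using col_eq[OF s, of "X (t + h)" "Y (t + h)" m] by (simp add: unit_square_def)
    qed
    then show "\<exists>e>0. \<forall>h\<in>{0..e}. t + h \<le> d \<longrightarrow> \<gamma> (t + h) = col s (X (t + h)) (Y (t + h))"
      using e(1) by blast
  next
    fix t assume t: "t0 < t" "t \<le> d"
    have "0 < t" using t0 t by simp
    from geodesic_backward[OF this] obtain e s' p1 p2 where e: "0 < e" "e \<le> t" "(s', (p1, p2)) \<in> \<gamma> t"
      and *: "\<And>h. 0 \<le> h \<Longrightarrow> h \<le> e \<Longrightarrow> (p1 - h * w, p2 - h * w * \<alpha>) \<in> unit_square"
        "\<And>h. 0 \<le> h \<Longrightarrow> h \<le> e \<Longrightarrow> \<gamma> (t - h) = surface_point F \<sigma> s' (p1 - h * w, p2 - h * w * \<alpha>)" by metis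
    \<comment> \<open>Going back at most half way to \<open>t0\<close> keeps the earlier point off
      the left edge, so that \<open>col_mem\<close> applies there; time \<open>t\<close> itself may
      lie on the right edge.\<close>
    have "\<gamma> t = col s (X t) (Y t)" if h: "0 \<le> h" "h \<le> e" "h \<le> (t - t0) / 2" "\<gamma> (t - h) = col s (X (t - h)) (Y (t - h))" for h
    proof (cases "h = 0")
      case True
      then show ?thesis using h by simp
    next
      case False
      then have X: "0 < X (t - h)" "X (t - h) < 1"
        using mono[of t0 "t - h"] mono[of "t - h" d] h t Xt0 Xd x by auto
      have mem: "(s', (p1 - h * w, p2 - h * w * \<alpha>)) \<in> col s (X (t - h)) (Y (t - h))"
        using *(2)[of h] h surface_point_self by metis
      obtain m where m: "s' = north_power m s" "p1 = X t" "p2 = Y t - of_int m"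
        by (rule col_mem[OF mem s X]) (use that in \<open>auto simp: shift\<close>)
      then show ?thesis
        using *[of 0] e(1) col_eq[OF s, of "X t" "Y t" m] by (auto simp: unit_square_def)
    qed
    then show "\<exists>e>0. \<forall>h\<in>{0..e}. t0 \<le> t - h \<longrightarrow> \<gamma> (t - h) = col s (X (t - h)) (Y (t - h)) \<longrightarrow>
        \<gamma> t = col s (X t) (Y t)"
      using e(1) t(1) by (intro exI[of _ "min e ((t - t0) / 2)"]) auto
  next
    show "t0 \<le> d" using x w_pos by (simp add: d_def)
  qed simp
  then show ?thesis using Xd w_pos by (simp add: d_def Y_def)
qed

lemma geodesic_coding:
  assumes "\<alpha> \<notin> \<rat>" and L: "int L dvd \<lfloor>\<alpha>\<rfloor>"
  obtains t1 s y c where "0 \<le> t1" "rotation_orbit F east north (frac \<alpha>) s y c"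
    "\<And>i x. 0 \<le> x \<Longrightarrow> x \<le> 1 \<Longrightarrow> \<gamma> (t1 + (real i + x) / w) = col (s i) x (y i + x * \<alpha>)"
proof -
  obtain t0 where t0: "0 \<le> t0" and nv: "\<And>t. t0 \<le> t \<Longrightarrow> \<not> vertex (\<gamma> t)"
    using eventually_no_vertex[OF assms(1)] by blast
  obtain s' x' y' where s': "s' \<in> F" and p: "0 \<le> x'" "x' \<le> 1" "0 \<le> y'" "y' \<le> 1"
    "\<gamma> t0 = surface_point F \<sigma> s' (x', y')"
    using surfaceE[OF geodesic_surface[OF t0]] by metis
  \<comment> \<open>The arrival at the right edge of the starting face's column; the coding begins
    on the left edge glued to it.\<close>
  define t1 where "t1 = t0 + (1 - x') / w"
  have t1: "t0 \<le> t1" using p w_pos by (simp add: t1_def)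
  have "\<gamma> t1 = col s' 1 (y' + (1 - x') * \<alpha>)"
    unfolding t1_def by (rule column_crossing[OF t0 nv]) (use s' p col_0 in auto)
  then obtain s0 y0 where s0: "s0 \<in> F" "0 \<le> y0" "y0 < 1" "\<gamma> t1 = col s0 0 y0"
    using col_east[OF s'] neighbour_opposite(1) north_power_mem[OF s'] frac_ge_0 frac_lt_1 by metis
  define next_state where "next_state = (\<lambda>(s, y).
    if 1 \<le> y + frac \<alpha> then (east (north s), y + frac \<alpha> - 1) else (east s, y + frac \<alpha>))"
  define s where "s i = fst ((next_state ^^ i) (s0, y0))" for i
  define y where "y i = snd ((next_state ^^ i) (s0, y0))" for i
  define c where "c i \<longleftrightarrow> 1 \<le> y i + frac \<alpha>" for i
  have s_Suc: "s (Suc i) = (if c i then east (north (s i)) else east (s i))"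
    and y_Suc: "y (Suc i) = (if c i then y i + frac \<alpha> - 1 else y i + frac \<alpha>)" for i
    by (simp_all add: s_def y_def c_def next_state_def split: prod.split)
  have frac: "0 \<le> frac \<alpha>" "frac \<alpha> < 1" by (simp_all add: frac_lt_1)
  have y01: "0 \<le> y i \<and> y i < 1" for i
  proof (induction i)
    case 0
    then show ?case using s0 by (simp add: y_def)
  next
    case (Suc i)
    then show ?case using frac by (auto simp: y_Suc c_def)
  qed
  have sF: "s i \<in> F" for i
    by (induction i) (use s0(1) neighbour_opposite(1) in \<open>auto simp: s_Suc s_def[of 0]\<close>)
  have orb: "rotation_orbit F east north (frac \<alpha>) s y c"
    unfolding rotation_orbit_def using sF y01 s_Suc y_Suc by (simp add: less_imp_le)
  have cross: "\<gamma> (t1 + (real i + x) / w) = col (s i) x (y i + x * \<alpha>)"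
    if "\<gamma> (t1 + real i / w) = col (s i) 0 (y i)" "0 \<le> x" "x \<le> 1" for i x
  proof -
    have le: "t0 \<le> t1 + real i / w" using t1 w_pos by (simp add: add_increasing2)
    then have "\<gamma> (t1 + real i / w + (x - 0) / w) = col (s i) x (y i + (x - 0) * \<alpha>)"
      by (intro column_crossing) (use nv t0 sF that in auto)
    then show ?thesis by (simp add: add_divide_distrib add.assoc)
  qed
  have left_edge: "\<gamma> (t1 + real i / w) = col (s i) 0 (y i)" for i
  proof (induction i)
    case 0
    then show ?case using s0 by (simp add: s_def y_def)
  next
    case (Suc i)
    \<comment> \<open>The integer part of the slope, possibly negative, contributes a power of
      \<open>north\<close> with exponent divisible by \<open>L\<close>, which acts trivially; only
      the carry remains.\<close>
    have fl: "\<lfloor>y i + \<alpha>\<rfloor> = \<lfloor>\<alpha>\<rfloor> + of_bool (c i)"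
      unfolding floor_eq_iff using y01[of i] frac by (simp add: c_def frac_def of_bool_def, linarith)
    have "\<gamma> (t1 + real (Suc i) / w) = col (s i) 1 (y i + \<alpha>)"
      using cross[OF Suc, of 1] by (simp add: add.commute)
    also have "\<dots> = col (east (north_power \<lfloor>y i + \<alpha>\<rfloor> (s i))) 0 (frac (y i + \<alpha>))"
      by (rule col_east[OF sF])
    also have "north_power \<lfloor>y i + \<alpha>\<rfloor> (s i) = (if c i then north (s i) else s i)"
      unfolding fl using north_power_mult[OF L] north_power_1[OF sF] by simp
    also have "frac (y i + \<alpha>) = y (Suc i)"
      unfolding frac_def fl y_Suc by simp
    finally show ?case by (simp add: s_Suc if_distrib)
  qed
  show ?thesis using that[of t1 s y c] orb cross[OF left_edge] t0 t1 by simp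
qed

end

text \<open>Flowing back from a point \<open>P\<close> to the left edge of its vertical street turns the vertical
  distance of \<open>P\<close> from the geodesic into a distance of heights on that edge.\<close>

theorem theorem6p4p1:
  fixes F :: "face set" and \<sigma> :: "face \<times> side \<Rightarrow> face \<times> side"
    and \<alpha> :: real and a :: "nat \<Rightarrow> int" and \<gamma> :: "real \<Rightarrow> local_point set"
  assumes "polysquare_translation_surface F \<sigma>"
    and "badly_approximable \<alpha>"
    and "cfrac_expansion \<alpha> a"
    and "\<And>i. int (street_LCM F \<sigma>) dvd a i"
    and "half_infinite_geodesic F \<sigma> \<alpha> \<gamma>"
  shows "superdense F \<sigma> \<gamma>"
proof -
  interpret polysquare_geodesic F \<sigma> \<alpha> \<gamma>
    by unfold_locales (use assms in auto)
  have irrational: "\<alpha> \<notin> \<rat>"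
  proof
    assume "\<alpha> \<in> \<rat>"
    then obtain P :: int and Q :: nat where "0 < Q" "\<alpha> = of_int P / of_nat Q"
      unfolding Rats_eq_int_div_nat by auto
    then show False using cfrac_expansion_irrational[OF assms(3), of Q P] by simp
  qed
  obtain a' B where a': "cfrac_expansion \<alpha> a'" "\<And>i. \<bar>a' i\<bar> \<le> B"
    using assms(2) unfolding badly_approximable_def by blast
  have B: "\<bar>a i\<bar> \<le> B" for i
    using a'(2)[of i] cfrac_expansion_unique[OF assms(3) a'(1), of i] by simp
  \<comment> \<open>The complete quotients of the slope; their fractional parts are the rotation
    numbers of the successive levels.\<close>
  define \<xi> where "\<xi> = rec_nat \<alpha> (\<lambda>k x. 1 / (x - of_int (a k)))"
  have expansion: "cfrac_expansion (\<xi> k) (\<lambda>i. a (i + k))" for k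
  proof (induction k)
    case (Suc k)
    then show ?case using cfrac_expansion_unfold(3)[OF Suc] by (simp add: \<xi>_def)
  qed (simp add: \<xi>_def assms(3))
  define b where "b k = \<xi> k - of_int (a k)" for k
  have digit: "1 \<le> a (Suc k)" for k using assms(3) by (simp add: cfrac_expansion_def)
  \<comment> \<open>The index is shifted by one because \<open>b 0\<close> is what remains after
    \<open>a 0\<close> is split off. The later digits are positive, so \<open>nat\<close> preserves
    them.\<close>
  interpret complete_quotients b "\<lambda>k. nat (a (Suc k))" L "nat B"
  proof
    fix k
    show "0 < b k" "b k < 1"
      using cfrac_expansion_unfold(1,2)[OF expansion[of k]] by (simp_all add: b_def)
    show "1 / b k = real (nat (a (Suc k))) + b (Suc k)"
      using digit[of k] by (simp add: b_def \<xi>_def)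
    show "L dvd nat (a (Suc k))" "1 \<le> nat (a (Suc k))" "nat (a (Suc k)) \<le> nat B"
      using assms(4)[of "Suc k"] digit[of k] B[of "Suc k"] by (auto simp: int_dvd_int_iff[symmetric])
  qed
  have b0: "b 0 = frac \<alpha>"
    using cfrac_expansion_head[OF assms(3)] by (simp add: b_def \<xi>_def frac_def)
  obtain K where K: "0 \<le> K" "\<And>e. 0 < e \<Longrightarrow> e \<le> 1 \<Longrightarrow> visits F east north (frac \<alpha>) (K / e) e"
    by (rule visits_linear[OF transitive_pair, unfolded b0]) (rule that; blast)
  have "int L dvd \<lfloor>\<alpha>\<rfloor>" using assms(4)[of 0] cfrac_expansion_head[OF assms(3)] by simp
  then obtain t1 s y c where t1: "0 \<le> t1" and orb: "rotation_orbit F east north (frac \<alpha>) s y c"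
    and cross: "\<And>i x. 0 \<le> x \<Longrightarrow> x \<le> 1 \<Longrightarrow> \<gamma> (t1 + (real i + x) / w) = col (s i) x (y i + x * \<alpha>)"
    using geodesic_coding[OF irrational] by metis
  \<comment> \<open>At most \<open>K * n\<close> full crossings and part of one more, each taking
    \<open>1 / w\<close>, after the delay \<open>t1\<close>; \<open>n \<ge> 1\<close> absorbs the
    constant terms.\<close>
  define C where "C = t1 + (K + 1) / w"
  have "\<exists>t\<in>{0..C * real n}. surface_dist F \<sigma> (\<gamma> t) P \<le> 1 / real n"
    if n: "1 \<le> n" and P: "P \<in> surface F \<sigma>" for n P
  proof -
    obtain r x h where r: "r \<in> F" "0 \<le> x" "x \<le> 1" "0 \<le> h" "h \<le> 1" "P = surface_point F \<sigma> r (x, h)"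
      using surfaceE[OF P] by metis
    define Z where "Z = h - x * \<alpha>"
    \<comment> \<open>The face whose left edge is met when flowing back from \<open>P\<close>; the
      height on that edge is \<open>frac Z\<close>.\<close>
    define r' where "r' = north_power \<lfloor>Z\<rfloor> r"
    have r': "r' \<in> F" using r by (simp add: r'_def north_power_mem)
    have P_col: "P = col r' x (frac Z + x * \<alpha>)"
      using r by (simp add: r'_def col_north_power frac_def Z_def col_0)
    have fZ: "frac Z \<in> {0..1}" by (simp add: frac_lt_1 less_imp_le)
    have "visits F east north (frac \<alpha>) (K / (1 / real n)) (1 / real n)"
      using n by (intro K(2)) simp_all
    moreover define \<kappa> where "\<kappa> \<longleftrightarrow> 1 \<le> frac Z + frac \<alpha>"
    have "if \<kappa> then 1 \<le> frac Z + frac \<alpha> else frac Z + frac \<alpha> \<le> 1" by (simp add: \<kappa>_def)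
    ultimately obtain i where i: "real i \<le> K * real n" "s i = r'" "\<bar>y i - frac Z\<bar> \<le> 1 / real n"
      using visitsD[OF _ orb r' fZ, of "K / (1 / real n)" "1 / real n" \<kappa>] by auto
    define t where "t = t1 + (real i + x) / w"
    have "surface_dist F \<sigma> (\<gamma> t) P \<le> \<bar>(y i + x * \<alpha>) - (frac Z + x * \<alpha>)\<bar>"
      unfolding t_def cross[OF r(2,3)] P_col i(2)
    proof (rule surface_dist_col[OF r' r(2,3)])
      have "1 / real n \<le> 1" using n by simp
      then show "\<bar>y i + x * \<alpha> - (frac Z + x * \<alpha>)\<bar> \<le> 1" using i(3) by simp
    qed
    also have "\<dots> \<le> 1 / real n" using i(3) by simp
    finally have "surface_dist F \<sigma> (\<gamma> t) P \<le> 1 / real n" .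
    moreover have "0 \<le> t" using t1 r(2) w_pos by (simp add: t_def)
    moreover have "t \<le> C * real n"
    proof -
      have "t1 \<le> t1 * real n" using mult_left_mono[of 1 "real n" t1] t1 n by simp
      moreover have "real i + x \<le> (K + 1) * real n" using n i(1) r(3) by (simp add: algebra_simps)
      ultimately have "t \<le> t1 * real n + (K + 1) * real n / w"
        unfolding t_def using w_pos by (intro add_mono divide_right_mono) auto
      then show ?thesis by (simp add: C_def algebra_simps)
    qed
    ultimately show ?thesis by (intro bexI[of _ t]) auto
  qed
  then show ?thesis unfolding superdense_def by blast
qed

end
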